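(* Let $N$ be a squarefree positive integer, let $K=\mathbb{Q}(\sqrt{-N})$ with discriminant $D$, let $\Sigma$ be the Hilbert class field of $K$, and let $\Sigma_0=\Sigma\cap\mathbb{R}$ be its real subfield. Let $p$ be an odd prime with Legendre symbol $\left(\frac{-N}{p}\right)=-1$. If $p$ has a prime divisor $\mathfrak{p}$ of degree $1$ (over $\mathbb{Q}$) in $\Sigma_0$, then $$\left(\frac{-p}{q}\right)=1 \quad\text{for every odd prime } q \text{ dividing } N.$$
   Context: $D$ is the fundamental discriminant of the imaginary quadratic field $K$ (so $-N$ is the squarefree part of $D$). The Hilbert class field $\Sigma$ is the maximal unramified abelian extension of $K$; it is Galois over $\mathbb{Q}$, and its real subfield $\Sigma_0$ is the fixed field of complex conjugation, with $[\Sigma_0:\mathbb{Q}]=h(D)$, the class number of $K$. A prime divisor of degree 1 in $\Sigma_0$ means a prime ideal of the ring of integers of $\Sigma_0$ lying over $p$ with residue degree $1$ over $\mathbb{Q}$. *)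

theory Defs
  imports
    "HOL-Algebra.Algebra"
    "HOL-Algebra.Algebraic_Closure_Type"
    "HOL-Number_Theory.Number_Theory"
    Complex_Main
begin

hide_const (open) Divisibility.prime

section \<open>Number fields inside the complex numbers\<close>

abbreviation complex_field :: "complex ring"
  where "complex_field \<equiv> ring_of_type_algebra"

definition number_field :: "complex set \<Rightarrow> bool"
  where "number_field K \<longleftrightarrow>
    subfield K complex_field \<and> ring.finite_dimension complex_field \<rat> K"

definition field_ring :: "complex set \<Rightarrow> complex ring"
  where "field_ring K = complex_field\<lparr>carrier := K\<rparr>"

definition integer_ring :: "complex set \<Rightarrow> complex ring"
  where "integer_ring K = complex_field\<lparr>carrier := {x \<in> K. algebraic_int x}\<rparr>"

definition imaginary_quadratic_field :: "nat \<Rightarrow> complex set"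
  where "imaginary_quadratic_field N =
    generate_field complex_field (insert (csqrt (- of_nat N)) \<rat>)"


section \<open>Primes in extensions of number fields\<close>

definition lies_over :: "complex set \<Rightarrow> complex set \<Rightarrow> complex set \<Rightarrow> bool"
  where "lies_over K Q P \<longleftrightarrow> Q \<inter> carrier (integer_ring K) = P"

text \<open>
  \<open>has_residue_degree K L Q f\<close>: the residue field of \<open>L\<close> at the prime \<open>Q\<close> has degree \<open>f\<close> over the
  residue field of \<open>K\<close> at the prime below \<open>Q\<close>. The latter is identified with its isomorphic
  image, the set of residue classes modulo \<open>Q\<close> of integers of \<open>K\<close>.
\<close>

definition has_residue_degree :: "complex set \<Rightarrow> complex set \<Rightarrow> complex set \<Rightarrow> nat \<Rightarrow> bool"
  where "has_residue_degree K L Q f \<longleftrightarrow>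
    ring.dimension (integer_ring L Quot Q) f
      ((\<lambda>a. Q +>\<^bsub>integer_ring L\<^esub> a) ` carrier (integer_ring K))
      (carrier (integer_ring L Quot Q))"

text \<open>
  The exponent of \<open>Q\<close> in the factorisation of the ideal that \<open>P\<close> generates in the ring of integers
  of \<open>L\<close>; powers and divisibility are those of the multiplicative monoid of ideals.
\<close>

definition ramification_index :: "complex set \<Rightarrow> complex set \<Rightarrow> complex set \<Rightarrow> nat"
  where "ramification_index L P Q =
    (GREATEST e. Q [^]\<^bsub>ideals_set (integer_ring L)\<^esub> e
       divides\<^bsub>ideals_set (integer_ring L)\<^esub> genideal (integer_ring L) P)"

definition ramifies_finite :: "complex set \<Rightarrow> complex set \<Rightarrow> complex set \<Rightarrow> bool"
  where "ramifies_finite K L P \<longleftrightarrow>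
    (\<exists>Q. primeideal Q (integer_ring L) \<and> lies_over K Q P \<and> ramification_index L P Q > 1)"

text \<open>
  An infinite prime of \<open>K\<close> ramifies in \<open>L\<close> if it is real and extends to a nonreal embedding of \<open>L\<close>.
\<close>

definition some_infinite_ramifies :: "complex set \<Rightarrow> complex set \<Rightarrow> bool"
  where "some_infinite_ramifies K L \<longleftrightarrow>
    (\<exists>\<tau> \<in> ring_hom (field_ring L) complex_field. \<tau> ` K \<subseteq> \<real> \<and> \<not> \<tau> ` L \<subseteq> \<real>)"

definition unramified_extension :: "complex set \<Rightarrow> complex set \<Rightarrow> bool"
  where "unramified_extension K L \<longleftrightarrow>
    (\<forall>P. primeideal P (integer_ring K) \<and> P \<noteq> {0} \<longrightarrow> \<not> ramifies_finite K L P) \<and>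
    \<not> some_infinite_ramifies K L"


section \<open>Abelian extensions and the Hilbert class field\<close>

definition galois_group :: "complex set \<Rightarrow> complex set \<Rightarrow> (complex \<Rightarrow> complex) monoid"
  where "galois_group K L = (BijGroup L)\<lparr>carrier :=
    {\<sigma> \<in> Bij L. \<sigma> \<in> ring_hom (field_ring L) (field_ring L) \<and> (\<forall>x\<in>K. \<sigma> x = x)}\<rparr>"

definition galois_extension :: "complex set \<Rightarrow> complex set \<Rightarrow> bool"
  where "galois_extension K L \<longleftrightarrow> number_field K \<and> number_field L \<and> K \<subseteq> L \<and>
    {x \<in> L. \<forall>\<sigma>\<in>carrier (galois_group K L). \<sigma> x = x} = K"

definition abelian_extension :: "complex set \<Rightarrow> complex set \<Rightarrow> bool"
  where "abelian_extension K L \<longleftrightarrow> galois_extension K L \<and> comm_group (galois_group K L)"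

text \<open>
  Maximal means largest: every unramified abelian extension of \<open>K\<close> is contained in \<open>H\<close>.
  Working inside the complex numbers loses no extension up to \<open>K\<close>-isomorphism.
\<close>

definition hilbert_class_field :: "complex set \<Rightarrow> complex set \<Rightarrow> bool"
  where "hilbert_class_field K H \<longleftrightarrow>
    abelian_extension K H \<and> unramified_extension K H \<and>
    (\<forall>M. abelian_extension K M \<and> unramified_extension K M \<longrightarrow> M \<subseteq> H)"

end

theory Submission
  imports Defs
begin

text \<open>
  Genus theory. For an odd prime \<open>q\<close> dividing \<open>N\<close> let \<open>r = \<plusminus>q\<close> with \<open>r \<equiv> 1 (mod 4)\<close>. Then \<open>K(\<surd>r) / K\<close> is
  abelian and unramified: modulo squares of \<open>K\<close> the radicand \<open>r\<close> may be replaced by \<open>- N / r\<close>, which is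
  prime to \<open>q\<close>. Hence \<open>\<surd>r\<close> lies in the Hilbert class field, and its real subfield contains \<open>\<surd>q\<close> if
  \<open>q \<equiv> 1 (mod 4)\<close> and \<open>\<surd>(q N)\<close> otherwise. Reducing this square root modulo a prime of degree 1 over
  \<open>p\<close> shows that \<open>q\<close>, respectively \<open>q N\<close>, is a quadratic residue modulo \<open>p\<close>, and quadratic reciprocity
  together with \<open>(-N / p) = -1\<close> turns this into \<open>(-p / q) = 1\<close>.
\<close>


text \<open>The ramification index lives in the monoid of ideals, and the argument uses neither
  unique factorisation nor cancellation there. From a divisor \<open>Q^e\<close> with
  \<open>e\<close> at least 2 it takes only an ideal \<open>I\<close> with \<open>E = Q I\<close>
  and \<open>I I\<close> inside \<open>E\<close>. The conclusion that would normally come from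
  cancelling \<open>E\<close> comes from a determinant, which needs a finite generating set; this is
  why ideals of \<open>integer_ring K\<close> are shown to have two generators. No single integral
  basis of \<open>K(w)\<close> over \<open>K\<close> is computed. Two integers suffice whose
  differences from their conjugates have squares \<open>r\<close> and \<open>4 m\<close>: these are
  coprime, so every prime of \<open>K(w)\<close> misses one of them. The sign of \<open>r\<close>
  has two effects. It makes \<open>(1 + w) / 2\<close> integral, so nothing ramifies above 2; and
  for \<open>q\<close> congruent to 3 mod 4 it makes \<open>w\<close> imaginary, so that
  \<open>w\<close> must be multiplied by the square root of \<open>-N\<close> to reach the real
  subfield, which brings the hypothesis on \<open>-N\<close> into the final computation.\<close>

section \<open>Subfields of the complex numbers\<close>

lemma complex_field_simps [simp]:
  "carrier complex_field = UNIV"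
  "x \<otimes>\<^bsub>complex_field\<^esub> y = x * y"
  "x \<oplus>\<^bsub>complex_field\<^esub> y = x + y"
  "\<zero>\<^bsub>complex_field\<^esub> = 0"
  "\<one>\<^bsub>complex_field\<^esub> = 1"
  by (simp_all add: ring_of_type_algebra_def)

lemma field_ring_simps [simp]:
  "carrier (field_ring L) = L"
  "x \<otimes>\<^bsub>field_ring L\<^esub> y = x * y"
  "x \<oplus>\<^bsub>field_ring L\<^esub> y = x + y"
  "\<zero>\<^bsub>field_ring L\<^esub> = 0"
  "\<one>\<^bsub>field_ring L\<^esub> = 1"
  by (simp_all add: field_ring_def)

lemma integer_ring_simps [simp]:
  "carrier (integer_ring L) = {x \<in> L. algebraic_int x}"
  "x \<otimes>\<^bsub>integer_ring L\<^esub> y = x * y"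
  "x \<oplus>\<^bsub>integer_ring L\<^esub> y = x + y"
  "\<zero>\<^bsub>integer_ring L\<^esub> = 0"
  "\<one>\<^bsub>integer_ring L\<^esub> = 1"
  by (simp_all add: integer_ring_def)

lemma complex_field_field: "Ring.field complex_field"
  by (rule field_from_type_algebra)

interpretation CF: Ring.cring complex_field
  by (rule cring_from_type_algebra)

lemma complex_field_a_inv [simp]: "\<ominus>\<^bsub>complex_field\<^esub> x = - x"
  using CF.minus_equality[of "- x" x] by simp

lemma complex_field_m_inv: "x \<noteq> 0 \<Longrightarrow> inv\<^bsub>complex_field\<^esub> x = inverse x"
  using CF.comm_inv_char[of x "inverse x"] by simp

lemma subfield_complexI:
  fixes F :: "complex set"
  assumes "1 \<in> F" and "\<And>x y. x \<in> F \<Longrightarrow> y \<in> F \<Longrightarrow> x + y \<in> F"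
    and "\<And>x y. x \<in> F \<Longrightarrow> y \<in> F \<Longrightarrow> x * y \<in> F"
    and "\<And>x. x \<in> F \<Longrightarrow> - x \<in> F" and "\<And>x. x \<in> F \<Longrightarrow> inverse x \<in> F"
  shows "subfield F complex_field"
proof (rule field.subfieldI'[OF complex_field_field])
  show "subring F complex_field"
    by (rule CF.subringI) (use assms in auto)
qed (use assms(5) complex_field_m_inv in auto)

lemma subfield_complexD:
  fixes F :: "complex set"
  assumes "subfield F complex_field"
  shows "0 \<in> F" and "1 \<in> F"
    and "\<And>x y. x \<in> F \<Longrightarrow> y \<in> F \<Longrightarrow> x + y \<in> F"
    and "\<And>x y. x \<in> F \<Longrightarrow> y \<in> F \<Longrightarrow> x * y \<in> F"
    and "\<And>x. x \<in> F \<Longrightarrow> - x \<in> F" and "\<And>x. x \<in> F \<Longrightarrow> inverse x \<in> F"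
    and "\<And>x y. x \<in> F \<Longrightarrow> y \<in> F \<Longrightarrow> x - y \<in> F"
    and "\<And>x y. x \<in> F \<Longrightarrow> y \<in> F \<Longrightarrow> x / y \<in> F"
proof -
  note sr = subringE[OF subfieldE(1)[OF assms]]
  show z: "0 \<in> F" and "1 \<in> F" and add: "\<And>x y. x \<in> F \<Longrightarrow> y \<in> F \<Longrightarrow> x + y \<in> F"
    and mult: "\<And>x y. x \<in> F \<Longrightarrow> y \<in> F \<Longrightarrow> x * y \<in> F" and neg: "\<And>x. x \<in> F \<Longrightarrow> - x \<in> F"
    using sr by auto
  show inverse: "inverse x \<in> F" if "x \<in> F" for x
    using CF.subfield_m_inv(1)[OF assms, of x] that z by (cases "x = 0") (auto simp: complex_field_m_inv)
  show "x - y \<in> F" if "x \<in> F" "y \<in> F" for x y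
    using add[OF that(1) neg[OF that(2)]] by simp
  show "x / y \<in> F" if "x \<in> F" "y \<in> F" for x y
    using mult[OF that(1) inverse[OF that(2)]] by (simp add: field_simps)
qed

lemma subfield_complex_of_int:
  assumes "subfield F complex_field"
  shows "of_int k \<in> F"
proof -
  note D = subfield_complexD[OF assms]
  have nat: "of_nat n \<in> F" for n
    by (induction n) (auto intro: D)
  show ?thesis
    using nat D(5) by (cases k rule: int_cases2) auto
qed

lemma number_field_Rats: "number_field \<rat>"
proof -
  have sf: "subfield \<rat> complex_field"
    by (rule subfield_complexI) auto
  have "CF.Span \<rat> [1] = \<rat>"
    by (auto simp: CF.line_extension_mem_iff)
  with CF.Span_finite_dimension[OF sf, of "[1]"] sf show ?thesis
    by (simp add: number_field_def)
qed


lemma algebraic_int_of_square: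
  fixes x :: complex
  assumes "x * x = of_int k"
  shows "algebraic_int x"
  by (rule algebraic_int.intros[of "[:- of_int k, 0, 1:]"])
    (use assms in \<open>auto simp: coeff_pCons split: nat.splits\<close>)


section \<open>Quadratic extensions\<close>

locale quadratic_extension =
  fixes F :: "complex set" and w :: complex
  assumes base: "number_field F" and w2: "w * w \<in> F" and w_notin: "w \<notin> F"
begin

lemma subfield_base: "subfield F complex_field"
  using base by (simp add: number_field_def)

lemmas baseI = subfield_complexD[OF subfield_base]

text \<open>Explicit coordinates, rather than a generated field, make the conjugation definable;
  \<open>M_eq_generate_field\<close> identifies the two descriptions.\<close>

definition M :: "complex set"
  where "M = {x + y * w | x y. x \<in> F \<and> y \<in> F}"

text \<open>The nontrivial automorphism of \<open>M\<close> over \<open>F\<close>, not complex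
  conjugation. It is meaningful only on \<open>M\<close>, where \<open>coords_unique\<close> makes
  the description definite.\<close>

definition conj :: "complex \<Rightarrow> complex"
  where "conj z = (THE s. \<exists>x\<in>F. \<exists>y\<in>F. z = x + y * w \<and> s = x - y * w)"

lemma coords_unique:
  assumes "x \<in> F" "y \<in> F" "x' \<in> F" "y' \<in> F" and eq: "x + y * w = x' + y' * w"
  shows "x = x'" and "y = y'"
proof -
  show *: "y = y'"
  proof (rule ccontr)
    assume "y \<noteq> y'"
    then have "w = (x' - x) / (y - y')"
      using eq by (simp add: field_simps)
    moreover have "(x' - x) / (y - y') \<in> F"
      by (intro baseI assms)
    ultimately show False
      using w_notin by simp
  qed
  then show "x = x'"
    using eq by simp
qed

lemma M_memI: "x \<in> F \<Longrightarrow> y \<in> F \<Longrightarrow> x + y * w \<in> M"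
  by (auto simp: M_def)

lemma M_cases [elim?]:
  assumes "z \<in> M"
  obtains x y where "x \<in> F" "y \<in> F" "z = x + y * w"
  using assms by (auto simp: M_def)

lemma conj_eq:
  assumes "x \<in> F" "y \<in> F"
  shows "conj (x + y * w) = x - y * w"
  unfolding conj_def
proof (rule the_equality)
  show "\<exists>x'\<in>F. \<exists>y'\<in>F. x + y * w = x' + y' * w \<and> x - y * w = x' - y' * w"
    using assms by blast
  show "s = x - y * w" if "\<exists>x'\<in>F. \<exists>y'\<in>F. x + y * w = x' + y' * w \<and> s = x' - y' * w" for s
    using that coords_unique[OF assms] by blast
qed

lemma base_subset: "F \<subseteq> M"
  using M_memI[of _ 0] baseI(1) by auto

lemma w_in: "w \<in> M"
  using M_memI[of 0 1] baseI by simp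

lemma subfield_M: "subfield M complex_field"
proof (rule subfield_complexI)
  show "1 \<in> M"
    using base_subset baseI(2) by blast
  show "a + b \<in> M" if ab: "a \<in> M" "b \<in> M" for a b
  proof -
    obtain x y x' y' where *: "x \<in> F" "y \<in> F" "x' \<in> F" "y' \<in> F" "a = x + y * w" "b = x' + y' * w"
      using ab unfolding M_def by blast
    have "a + b = (x + x') + (y + y') * w"
      by (simp only: *) (simp add: algebra_simps)
    also have "\<dots> \<in> M"
      by (intro M_memI baseI w2 *)
    finally show ?thesis .
  qed
  show "a * b \<in> M" if ab: "a \<in> M" "b \<in> M" for a b
  proof -
    obtain x y x' y' where *: "x \<in> F" "y \<in> F" "x' \<in> F" "y' \<in> F" "a = x + y * w" "b = x' + y' * w"
      using ab unfolding M_def by blast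
    have "a * b = (x * x' + y * y' * (w * w)) + (x * y' + y * x') * w"
      by (simp only: *) (simp add: algebra_simps)
    also have "\<dots> \<in> M"
      by (intro M_memI baseI w2 *)
    finally show ?thesis .
  qed
  show "- a \<in> M" if a: "a \<in> M" for a
  proof -
    obtain x y where *: "x \<in> F" "y \<in> F" "a = x + y * w"
      using a unfolding M_def by blast
    have "- a = (- x) + (- y) * w"
      by (simp only: *) (simp add: algebra_simps)
    also have "\<dots> \<in> M"
      by (intro M_memI baseI w2 *)
    finally show ?thesis .
  qed
  show "inverse a \<in> M" if a: "a \<in> M" for a
  proof -
    obtain x y where *: "x \<in> F" "y \<in> F" "a = x + y * w"
      using a unfolding M_def by blast
    show ?thesis
    proof (cases "a = 0")
      case True
      then show ?thesis
        using base_subset baseI(1) by auto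
    next
      case False
      have "x - y * w \<noteq> 0"
      proof
        assume "x - y * w = 0"
        then have "x + (- y) * w = 0 + 0 * w"
          by simp
        with * have "x = 0" "- y = 0"
          using coords_unique[of x "- y" 0 0] baseI by blast+
        with * False show False
          by simp
      qed
      \<comment> \<open>Rationalise the denominator: the norm of \<open>a\<close> lies in
        \<open>F\<close>.\<close>
      then have "inverse a = (x - y * w) / (a * (x - y * w))"
        using False by (simp add: field_simps)
      also have "a * (x - y * w) = x * x - y * y * (w * w)" (is "_ = ?n")
        by (simp add: * algebra_simps)
      also have "(x - y * w) / ?n = x / ?n + (- y / ?n) * w"
        by (simp add: diff_divide_distrib)
      also have "\<dots> \<in> M"
        by (intro M_memI baseI w2 *)
      finally show ?thesis .
    qed
  qed
qed

lemmas MI = subfield_complexD[OF subfield_M]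

lemma number_field_M: "number_field M"
proof -
  have "CF.Span F [w, 1] = M"
  proof (rule Set.set_eqI)
    fix u
    have "CF.line_extension F 1 {0} = F"
      by (auto simp: CF.line_extension_mem_iff)
    then have "u \<in> CF.Span F [w, 1] \<longleftrightarrow> (\<exists>y\<in>F. \<exists>x\<in>F. u = x + y * w)"
      by (simp add: CF.line_extension_mem_iff add.commute)
    then show "u \<in> CF.Span F [w, 1] \<longleftrightarrow> u \<in> M"
      unfolding M_def by blast
  qed
  then have "CF.finite_dimension F M"
    using CF.Span_finite_dimension[OF subfield_base, of "[w, 1]"] by simp
  then have "CF.finite_dimension \<rat> M"
    using CF.telescopic_base_dim(1)[of \<rat> F M] number_field_Rats base subfield_base
    by (simp add: number_field_def)
  then show ?thesis
    using subfield_M by (simp add: number_field_def)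
qed

lemma M_least:
  assumes "subfield L complex_field" "F \<subseteq> L" "w \<in> L"
  shows "M \<subseteq> L"
proof
  fix z
  assume "z \<in> M"
  then obtain x y where *: "x \<in> L" "y \<in> L" "z = x + y * w"
    using assms(2) unfolding M_def by blast
  show "z \<in> L"
    unfolding *(3) by (intro subfield_complexD(3,4)[OF assms(1)] * assms(3))
qed

lemma M_eq_generate_field: "M = generate_field complex_field (insert w F)"
proof (rule field.generate_fieldI[OF complex_field_field])
  show "M \<subseteq> L" if "subfield L complex_field" "insert w F \<subseteq> L" for L
    using that by (intro M_least) simp_all
qed (simp_all add: subfield_M base_subset w_in)

section \<open>Conjugation over the base field\<close>

lemma conj_base: "x \<in> F \<Longrightarrow> conj x = x"
  using conj_eq[of x 0] baseI by simp

lemma conj_in: "z \<in> M \<Longrightarrow> conj z \<in> M"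
proof (erule M_cases)
  fix x y
  assume "x \<in> F" "y \<in> F" "z = x + y * w"
  then show "conj z \<in> M"
    using M_memI[of x "- y"] baseI by (simp add: conj_eq)
qed

lemma conj_add: "a \<in> M \<Longrightarrow> b \<in> M \<Longrightarrow> conj (a + b) = conj a + conj b"
proof -
  assume ab: "a \<in> M" "b \<in> M"
  obtain x y x' y' where *: "x \<in> F" "y \<in> F" "x' \<in> F" "y' \<in> F" "a = x + y * w" "b = x' + y' * w"
    using ab unfolding M_def by blast
  have "a + b = (x + x') + (y + y') * w"
    by (simp only: *) (simp add: algebra_simps)
  moreover have "x + x' \<in> F" "y + y' \<in> F"
    by (intro baseI *)+
  ultimately have "conj (a + b) = (x + x') - (y + y') * w"
    using conj_eq by simp
  moreover have "conj a = x - y * w" "conj b = x' - y' * w"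
    using * by (simp_all only: conj_eq)
  ultimately show ?thesis
    by (simp only:) (simp add: algebra_simps)
qed

lemma conj_mult: "a \<in> M \<Longrightarrow> b \<in> M \<Longrightarrow> conj (a * b) = conj a * conj b"
proof -
  assume ab: "a \<in> M" "b \<in> M"
  obtain x y x' y' where *: "x \<in> F" "y \<in> F" "x' \<in> F" "y' \<in> F" "a = x + y * w" "b = x' + y' * w"
    using ab unfolding M_def by blast
  have "a * b = (x * x' + y * y' * (w * w)) + (x * y' + y * x') * w"
    by (simp only: *) (simp add: algebra_simps)
  moreover have "x * x' + y * y' * (w * w) \<in> F" "x * y' + y * x' \<in> F"
    by (intro baseI w2 *)+
  ultimately have "conj (a * b) = (x * x' + y * y' * (w * w)) - (x * y' + y * x') * w"
    using conj_eq by simp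
  moreover have "conj a = x - y * w" "conj b = x' - y' * w"
    using * by (simp_all only: conj_eq)
  ultimately show ?thesis
    by (simp only:) (simp add: algebra_simps)
qed

lemma conj_diff:
  assumes "x \<in> F" "y \<in> F"
  shows "conj (x - y * w) = x + y * w"
  using conj_eq[of x "- y"] assms baseI by simp

lemma conj_conj: "z \<in> M \<Longrightarrow> conj (conj z) = z"
  by (erule M_cases) (simp add: conj_eq conj_diff)

lemma trace_in_base: "z \<in> M \<Longrightarrow> z + conj z \<in> F"
proof (erule M_cases)
  fix x y
  assume "x \<in> F" "y \<in> F" "z = x + y * w"
  then show "z + conj z \<in> F"
    using baseI(3)[of x x] by (simp add: conj_eq)
qed

lemma conj_fixed: "z \<in> M \<Longrightarrow> conj z = z \<Longrightarrow> z \<in> F"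
proof -
  assume "z \<in> M" "conj z = z"
  then have "z = (z + conj z) / of_int 2"
    by simp
  also have "\<dots> \<in> F"
    by (intro baseI(8) trace_in_base \<open>z \<in> M\<close> subfield_complex_of_int[OF subfield_base])
  finally show ?thesis .
qed

text \<open>The coefficients of a monic integer polynomial lie in \<open>F\<close> and are fixed by
  \<open>conj\<close>, so \<open>conj z\<close> is a root of the same polynomial as
  \<open>z\<close>.\<close>

lemma conj_algebraic_int:
  assumes "z \<in> M" "algebraic_int z"
  shows "algebraic_int (conj z)"
proof -
  obtain p where p: "lead_coeff p = 1" "\<forall>i. coeff p i \<in> \<int>" "poly p z = 0"
    using assms(2) by (auto elim: algebraic_int.cases)
  have "poly p z \<in> M \<and> conj (poly p z) = poly p (conj z)"
    using p(2)
  proof (induction p)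
    case 0
    then show ?case
      using MI(1) conj_base[OF baseI(1)] by simp
  next
    case (pCons a p)
    have "a \<in> \<int>"
      using pCons.prems[rule_format, of 0] by simp
    then have aF: "a \<in> F"
      using subfield_complex_of_int[OF subfield_base] by (auto elim: Ints_cases)
    then have aM: "a \<in> M"
      using base_subset by blast
    have "\<forall>i. coeff p i \<in> \<int>"
      using pCons.prems by (metis coeff_pCons_Suc)
    with pCons.IH have IH: "poly p z \<in> M" "conj (poly p z) = poly p (conj z)"
      by auto
    show ?case
      using IH aM aF assms(1) by (simp add: MI conj_add conj_mult conj_base)
  qed
  then have "poly p (conj z) = 0"
    using p(3) conj_base[OF baseI(1)] by simp
  with p show ?thesis
    by (intro algebraic_int.intros)
qed

text \<open>An automorphism preserves \<open>w * w\<close>, so it sends \<open>w\<close> to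
  \<open>w\<close> or \<open>- w\<close>. The group is thereby described by a sign, from which
  involutivity and commutativity follow.\<close>

lemma galois_group_action:
  assumes "\<tau> \<in> carrier (galois_group F M)"
  obtains e where "e = 1 \<or> e = - 1" "\<And>x y. x \<in> F \<Longrightarrow> y \<in> F \<Longrightarrow> \<tau> (x + y * w) = x + (y * e) * w"
proof -
  have hom: "\<tau> \<in> ring_hom (field_ring M) (field_ring M)" and fixed: "\<And>x. x \<in> F \<Longrightarrow> \<tau> x = x"
    using assms by (auto simp: galois_group_def)
  have mult: "\<tau> (x * y) = \<tau> x * \<tau> y" if "x \<in> M" "y \<in> M" for x y
    using ring_hom_mult[OF hom, of x y] that by simp
  have add: "\<tau> (x + y) = \<tau> x + \<tau> y" if "x \<in> M" "y \<in> M" for x y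
    using ring_hom_add[OF hom, of x y] that by simp
  have "\<tau> w * \<tau> w = w * w"
    using mult[OF w_in w_in] fixed[OF w2] by simp
  then have "\<tau> w = w \<or> \<tau> w = - w"
    by (simp add: square_eq_iff)
  then obtain e where e: "e = 1 \<or> e = - 1" "\<tau> w = e * w"
    by (metis mult_1 mult_minus1)
  have "\<tau> (x + y * w) = x + (y * e) * w" if "x \<in> F" "y \<in> F" for x y
  proof -
    have "x \<in> M" "y \<in> M"
      using that base_subset by auto
    then show ?thesis
      using that e(2) by (simp add: add mult fixed w_in MI(4))
  qed
  with e(1) show ?thesis
    using that by blast
qed

section \<open>The Galois group of a quadratic extension\<close>

lemma galois_group_mult:
  assumes "\<sigma> \<in> carrier (galois_group F M)" "\<tau> \<in> carrier (galois_group F M)"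
  shows "\<sigma> \<otimes>\<^bsub>galois_group F M\<^esub> \<tau> = compose M \<sigma> \<tau>"
  using assms by (simp add: galois_group_def BijGroup_def)

lemma galois_group_one: "\<one>\<^bsub>galois_group F M\<^esub> = (\<lambda>x\<in>M. x)"
  by (simp add: galois_group_def BijGroup_def)

text \<open>Asking for an involution gives bijectivity at once and loses nothing, since by
  \<open>galois_group_facts\<close> every element of this group is one.\<close>

lemma galois_groupI:
  assumes "\<sigma> \<in> extensional M" "\<And>x. x \<in> M \<Longrightarrow> \<sigma> x \<in> M" "\<And>x. x \<in> M \<Longrightarrow> \<sigma> (\<sigma> x) = x"
    and "\<And>x y. x \<in> M \<Longrightarrow> y \<in> M \<Longrightarrow> \<sigma> (x + y) = \<sigma> x + \<sigma> y"
    and "\<And>x y. x \<in> M \<Longrightarrow> y \<in> M \<Longrightarrow> \<sigma> (x * y) = \<sigma> x * \<sigma> y"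
    and "\<And>x. x \<in> F \<Longrightarrow> \<sigma> x = x"
  shows "\<sigma> \<in> carrier (galois_group F M)"
proof -
  have "bij_betw \<sigma> M M"
    by (rule bij_betwI[where g = \<sigma>]) (use assms in auto)
  moreover have "\<sigma> \<in> ring_hom (field_ring M) (field_ring M)"
    by (rule ring_hom_memI) (use assms baseI in auto)
  ultimately show ?thesis
    using assms by (simp add: galois_group_def Bij_def)
qed

lemma galois_group_facts:
  assumes "\<sigma> \<in> carrier (galois_group F M)"
  shows "\<sigma> \<in> extensional M" and "\<And>x. x \<in> M \<Longrightarrow> \<sigma> x \<in> M" and "\<And>x. x \<in> M \<Longrightarrow> \<sigma> (\<sigma> x) = x"
    and "\<And>x y. x \<in> M \<Longrightarrow> y \<in> M \<Longrightarrow> \<sigma> (x + y) = \<sigma> x + \<sigma> y"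
    and "\<And>x y. x \<in> M \<Longrightarrow> y \<in> M \<Longrightarrow> \<sigma> (x * y) = \<sigma> x * \<sigma> y"
    and "\<And>x. x \<in> F \<Longrightarrow> \<sigma> x = x"
proof -
  have hom: "\<sigma> \<in> ring_hom (field_ring M) (field_ring M)"
    using assms by (auto simp: galois_group_def)
  show "\<sigma> \<in> extensional M" and "\<And>x. x \<in> F \<Longrightarrow> \<sigma> x = x"
    using assms by (auto simp: galois_group_def Bij_def)
  show "\<And>x. x \<in> M \<Longrightarrow> \<sigma> x \<in> M"
    and "\<And>x y. x \<in> M \<Longrightarrow> y \<in> M \<Longrightarrow> \<sigma> (x + y) = \<sigma> x + \<sigma> y"
    and "\<And>x y. x \<in> M \<Longrightarrow> y \<in> M \<Longrightarrow> \<sigma> (x * y) = \<sigma> x * \<sigma> y"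
    using ring_hom_closed[OF hom] ring_hom_add[OF hom] ring_hom_mult[OF hom] by auto
  show "\<sigma> (\<sigma> z) = z" if z: "z \<in> M" for z
  proof -
    obtain x y where xy: "x \<in> F" "y \<in> F" "z = x + y * w"
      using M_cases[OF z] by blast
    obtain e where e: "e = 1 \<or> e = - 1"
      and \<sigma>: "\<And>x y. x \<in> F \<Longrightarrow> y \<in> F \<Longrightarrow> \<sigma> (x + y * w) = x + (y * e) * w"
      using galois_group_action[OF assms] by blast
    have "y * e \<in> F"
      using e xy baseI by auto
    then have "\<sigma> (\<sigma> z) = x + (y * e * e) * w"
      using xy \<sigma> by simp
    with xy(3) e show ?thesis
      by auto
  qed
qed

lemma galois_group_commute:
  assumes \<sigma>: "\<sigma> \<in> carrier (galois_group F M)" and \<tau>: "\<tau> \<in> carrier (galois_group F M)" and z: "z \<in> M"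
  shows "\<sigma> (\<tau> z) = \<tau> (\<sigma> z)"
proof -
  obtain x y where xy: "x \<in> F" "y \<in> F" "z = x + y * w"
    using M_cases[OF z] by blast
  obtain d where d: "d = 1 \<or> d = - 1"
    and \<sigma>: "\<And>x y. x \<in> F \<Longrightarrow> y \<in> F \<Longrightarrow> \<sigma> (x + y * w) = x + (y * d) * w"
    using galois_group_action[OF \<sigma>] by blast
  obtain e where e: "e = 1 \<or> e = - 1"
    and \<tau>: "\<And>x y. x \<in> F \<Longrightarrow> y \<in> F \<Longrightarrow> \<tau> (x + y * w) = x + (y * e) * w"
    using galois_group_action[OF \<tau>] by blast
  have "y * d \<in> F" "y * e \<in> F"
    using d e xy baseI by auto
  then have "\<sigma> (\<tau> z) = x + (y * e * d) * w" "\<tau> (\<sigma> z) = x + (y * d * e) * w"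
    using xy \<sigma> \<tau> by simp_all
  then show ?thesis
    by (simp add: mult_ac)
qed

lemma comm_group_galois_group: "comm_group (galois_group F M)"
proof (rule comm_groupI)
  note G = galois_group_facts
  have compose: "compose M \<sigma> \<tau> \<in> carrier (galois_group F M)"
    if \<sigma>: "\<sigma> \<in> carrier (galois_group F M)" and \<tau>: "\<tau> \<in> carrier (galois_group F M)" for \<sigma> \<tau>
  proof (rule galois_groupI)
    show "compose M \<sigma> \<tau> \<in> extensional M"
      by simp
    show "compose M \<sigma> \<tau> x \<in> M" if "x \<in> M" for x
      using that G(2)[OF \<sigma>] G(2)[OF \<tau>] by (simp add: compose_eq)
    show "compose M \<sigma> \<tau> (compose M \<sigma> \<tau> x) = x" if "x \<in> M" for x
      using that G(2)[OF \<sigma>] G(2)[OF \<tau>] G(3)[OF \<sigma>] G(3)[OF \<tau>] galois_group_commute[OF \<sigma> \<tau>]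
      by (simp add: compose_eq)
    show "compose M \<sigma> \<tau> (x + y) = compose M \<sigma> \<tau> x + compose M \<sigma> \<tau> y" if "x \<in> M" "y \<in> M" for x y
      using that G(2,4)[OF \<sigma>] G(2,4)[OF \<tau>] MI(3) by (simp add: compose_eq)
    show "compose M \<sigma> \<tau> (x * y) = compose M \<sigma> \<tau> x * compose M \<sigma> \<tau> y" if "x \<in> M" "y \<in> M" for x y
      using that G(2,5)[OF \<sigma>] G(2,5)[OF \<tau>] MI(4) by (simp add: compose_eq)
    show "compose M \<sigma> \<tau> x = x" if "x \<in> F" for x
      using that base_subset G(6)[OF \<sigma>] G(6)[OF \<tau>] by (simp add: compose_eq subset_iff)
  qed
  show one: "\<one>\<^bsub>galois_group F M\<^esub> \<in> carrier (galois_group F M)"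
    unfolding galois_group_one
    by (rule galois_groupI) (use MI base_subset in auto)
  show mult: "\<sigma> \<otimes>\<^bsub>galois_group F M\<^esub> \<tau> \<in> carrier (galois_group F M)"
    if "\<sigma> \<in> carrier (galois_group F M)" "\<tau> \<in> carrier (galois_group F M)" for \<sigma> \<tau>
    using that compose by (simp add: galois_group_mult)
  show "\<sigma> \<otimes>\<^bsub>galois_group F M\<^esub> \<tau> \<otimes>\<^bsub>galois_group F M\<^esub> \<rho> = \<sigma> \<otimes>\<^bsub>galois_group F M\<^esub> (\<tau> \<otimes>\<^bsub>galois_group F M\<^esub> \<rho>)"
    if "\<sigma> \<in> carrier (galois_group F M)" "\<tau> \<in> carrier (galois_group F M)" "\<rho> \<in> carrier (galois_group F M)"
    for \<sigma> \<tau> \<rho>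
  proof -
    have "\<rho> \<in> M \<rightarrow> M"
      using G(2)[OF that(3)] by auto
    then show ?thesis
      using that by (simp add: galois_group_mult compose compose_assoc)
  qed
  show "\<sigma> \<otimes>\<^bsub>galois_group F M\<^esub> \<tau> = \<tau> \<otimes>\<^bsub>galois_group F M\<^esub> \<sigma>"
    if "\<sigma> \<in> carrier (galois_group F M)" "\<tau> \<in> carrier (galois_group F M)" for \<sigma> \<tau>
    using that galois_group_commute[OF that]
    by (auto simp: galois_group_mult compose_def restrict_def)
  show "\<one>\<^bsub>galois_group F M\<^esub> \<otimes>\<^bsub>galois_group F M\<^esub> \<sigma> = \<sigma>" if "\<sigma> \<in> carrier (galois_group F M)" for \<sigma>
  proof -
    have "compose M (\<lambda>x\<in>M. x) \<sigma> = \<sigma>"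
      by (rule extensionalityI[of _ M]) (use G(1,2)[OF that] in \<open>auto simp: compose_eq\<close>)
    then show ?thesis
      using galois_group_mult[OF one that] by (simp add: galois_group_one)
  qed
  show "\<exists>\<tau>\<in>carrier (galois_group F M). \<tau> \<otimes>\<^bsub>galois_group F M\<^esub> \<sigma> = \<one>\<^bsub>galois_group F M\<^esub>"
    if "\<sigma> \<in> carrier (galois_group F M)" for \<sigma>
  proof
    show "\<sigma> \<otimes>\<^bsub>galois_group F M\<^esub> \<sigma> = \<one>\<^bsub>galois_group F M\<^esub>"
      unfolding galois_group_mult[OF that that] galois_group_one
      by (rule extensionalityI[of _ M]) (use G(3)[OF that] in \<open>auto simp: compose_eq\<close>)
  qed (rule that)
qed

lemma abelian_extension: "abelian_extension F M"
proof -
  \<comment> \<open>Elements of \<open>Bij M\<close> are extensional, hence \<open>restrict\<close>.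
    This one automorphism already cuts the fixed field down to \<open>F\<close>.\<close>
  have "restrict conj M \<in> carrier (galois_group F M)"
  proof (rule galois_groupI)
    show "restrict conj M x = x" if "x \<in> F" for x
      using that base_subset conj_base by auto
  qed (simp_all add: conj_in conj_conj conj_add conj_mult MI)
  then have "z \<in> F" if "z \<in> M" "\<forall>\<sigma>\<in>carrier (galois_group F M). \<sigma> z = z" for z
    using that conj_fixed[of z] by (metis restrict_apply')
  then have "{z \<in> M. \<forall>\<sigma>\<in>carrier (galois_group F M). \<sigma> z = z} = F"
    using base_subset galois_group_facts(6) by blast
  then show ?thesis
    using base number_field_M base_subset comm_group_galois_group
    by (simp add: abelian_extension_def galois_extension_def)
qed

end


section \<open>A criterion for being unramified\<close>

text \<open>The combinations of \<open>p\<close> and \<open>q\<close> form the sum of two principal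
  ideals, an ideal containing \<open>S\<close>, so minimality of the generated ideal
  applies.\<close>

lemma genideal_two_generators:
  assumes "cring R" "p \<in> carrier R" "q \<in> carrier R"
    and S: "S \<subseteq> {p \<otimes>\<^bsub>R\<^esub> a \<oplus>\<^bsub>R\<^esub> q \<otimes>\<^bsub>R\<^esub> b | a b. a \<in> carrier R \<and> b \<in> carrier R}"
    and x: "x \<in> genideal R S"
  obtains a b where "a \<in> carrier R" "b \<in> carrier R" "x = p \<otimes>\<^bsub>R\<^esub> a \<oplus>\<^bsub>R\<^esub> q \<otimes>\<^bsub>R\<^esub> b"
proof -
  interpret R: cring R by fact
  have "ideal (PIdl\<^bsub>R\<^esub> p <+>\<^bsub>R\<^esub> PIdl\<^bsub>R\<^esub> q) R"
    using assms(2,3) by (intro R.add_ideals R.cgenideal_ideal)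
  moreover have eq: "PIdl\<^bsub>R\<^esub> p <+>\<^bsub>R\<^esub> PIdl\<^bsub>R\<^esub> q =
    {p \<otimes>\<^bsub>R\<^esub> a \<oplus>\<^bsub>R\<^esub> q \<otimes>\<^bsub>R\<^esub> b | a b. a \<in> carrier R \<and> b \<in> carrier R}" (is "?I = ?J")
  proof -
    have "PIdl\<^bsub>R\<^esub> r = {r \<otimes>\<^bsub>R\<^esub> a | a. a \<in> carrier R}" if "r \<in> carrier R" for r
      unfolding cgenideal_def using R.m_comm[OF that] by metis
    note * = this[OF assms(2)] this[OF assms(3)]
    show ?thesis
      unfolding set_add_def' * by auto
  qed
  ultimately have "x \<in> ?J"
    using R.genideal_minimal[of ?J S] S x by auto
  then show ?thesis
    using that by blast
qed

context cring
begin

text \<open>If \<open>E = Q^e J\<close>, put \<open>T = Q^(e-2) J\<close> and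
  \<open>I = Q T\<close>. Then \<open>E = Q I\<close>, and \<open>I I = Q Q T T = E T\<close> lies
  in \<open>E\<close>. Only commutativity of ideal multiplication is used.\<close>

lemma ideal_power_dvdD:
  assumes Q: "ideal Q R" and E: "ideal E R"
    and dvd: "Q [^]\<^bsub>ideals_set R\<^esub> (e :: nat) divides\<^bsub>ideals_set R\<^esub> E" and e: "e \<ge> 2"
  obtains I where "ideal I R" "I \<subseteq> Q" "E = Q \<cdot> I" "I \<cdot> I \<subseteq> E"
proof -
  interpret S: comm_monoid "ideals_set R"
    by (rule ideals_set_is_comm_monoid)
  have carr: "carrier (ideals_set R) = {I. ideal I R}" and mult: "(\<otimes>\<^bsub>ideals_set R\<^esub>) = (\<cdot>)"
    by (simp_all add: ideals_set_def)
  obtain J where J: "ideal J R" "E = Q [^]\<^bsub>ideals_set R\<^esub> e \<otimes>\<^bsub>ideals_set R\<^esub> J"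
    using dvd by (auto simp: factor_def carr)
  obtain k where k: "e = Suc (Suc k)"
    using e by (metis add_2_eq_Suc le_Suc_ex)
  define T where "T = Q [^]\<^bsub>ideals_set R\<^esub> k \<otimes>\<^bsub>ideals_set R\<^esub> J"
  have c: "Q \<in> carrier (ideals_set R)" "J \<in> carrier (ideals_set R)"
    using Q J by (simp_all add: carr)
  have Tc: "T \<in> carrier (ideals_set R)"
    using S.m_closed[OF S.nat_pow_closed[OF c(1)] c(2)] by (simp add: T_def)
  then have T: "ideal T R"
    by (simp add: carr)
  then have QT: "ideal (Q \<cdot> T) R"
    using ideal_prod_is_ideal Q by simp
  have E_eq: "E = Q \<cdot> (Q \<cdot> T)"
    using c unfolding J(2) k T_def mult[symmetric] by (simp add: S.m_ac)
  have "(Q \<cdot> T) \<cdot> (Q \<cdot> T) = E \<cdot> T"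
    using c Tc unfolding E_eq mult[symmetric] by (simp add: S.m_ac)
  moreover have "E \<cdot> T \<subseteq> E"
    using ideal_prod_inter[OF E T] by blast
  moreover have "Q \<cdot> T \<subseteq> Q"
    using ideal_prod_inter[OF Q T] by blast
  ultimately show ?thesis
    using that QT E_eq by auto
qed

end

context quadratic_extension
begin

text \<open>
  If \<open>Q\<^sup>e\<close> divides \<open>E = P O\<close> with \<open>e \<ge> 2\<close>, write \<open>E = Q I\<close> with \<open>I \<cdot> I \<subseteq> E\<close>. Elements of \<open>I\<close> and their
  conjugates lie in \<open>Q\<close>, so their traces lie in \<open>P\<close>, and expanding them along \<open>1, \<beta>\<close> gives
  \<open>d\<^sup>2 I \<subseteq> E\<close> for \<open>d = \<beta> - conj \<beta>\<close>. Hence \<open>d\<^sup>2 E \<subseteq> Q E\<close>, and the determinant trick for the two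
  generators of \<open>P\<close> puts \<open>d\<close> into \<open>Q\<close>.
\<close>

lemma ramification_index_le_1:
  assumes P: "primeideal P (integer_ring F)" "P \<noteq> {0}"
    and Q: "primeideal Q (integer_ring M)" and over: "lies_over F Q P"
    and \<beta>: "\<beta> \<in> M" "algebraic_int \<beta>" "\<beta> - conj \<beta> \<notin> Q"
    and gens: "p1 \<in> P" "p2 \<in> P" "\<And>x. x \<in> P \<Longrightarrow> \<exists>m n. x = of_int m * p1 + of_int n * p2"
  shows "ramification_index M P Q \<le> 1"
proof -
  define R where "R = integer_ring M"
  interpret P: primeideal P "integer_ring F" by (rule P)
  interpret Q: primeideal Q R unfolding R_def by (rule Q)
  have R_simps [simp]: "carrier R = {x \<in> M. algebraic_int x}" "x \<otimes>\<^bsub>R\<^esub> y = x * y" "x \<oplus>\<^bsub>R\<^esub> y = x + y"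
    "\<zero>\<^bsub>R\<^esub> = 0" "\<one>\<^bsub>R\<^esub> = 1" for x y
    by (simp_all add: R_def)
  have a_inv [simp]: "\<ominus>\<^bsub>R\<^esub> x = - x" if "x \<in> carrier R" for x
    using that Q.minus_equality[of "- x" x] MI(5)[of x] by simp
  have R_add: "x + y \<in> carrier R" and R_mult: "x * y \<in> carrier R" and R_diff: "x - y \<in> carrier R"
    if "x \<in> carrier R" "y \<in> carrier R" for x y
    using that Q.a_closed[of x y] Q.m_closed[of x y] Q.minus_closed[of x y]
    by (simp_all add: a_minus_def)
  have Q_carrier: "x \<in> carrier R" if "x \<in> Q" for x
    using that by (rule Q.Icarr)
  have Q_add: "x + y \<in> Q" if "x \<in> Q" "y \<in> Q" for x y
    using additive_subgroup.a_closed[OF Q.is_additive_subgroup that] by simp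
  have Q_mult: "x * y \<in> Q" "y * x \<in> Q" if "x \<in> Q" "y \<in> carrier R" for x y
    using Q.I_r_closed[of x y] Q.I_l_closed[of x y] that by simp_all
  have Q_prime: "x \<in> Q" if "x * x \<in> Q" "x \<in> carrier R" for x
    using Q.I_prime[of x x] that by simp
  have int_R: "of_int k \<in> carrier R" for k
    using subfield_complex_of_int[OF subfield_M] by auto
  have Q_diff: "x - y \<in> Q" if "x \<in> Q" "y \<in> Q" for x y
    using Q_add[of x "- y"] Q_mult(1)[OF that(2) int_R[of "- 1"]] that by simp
  have conj_R: "conj x \<in> carrier R" if "x \<in> carrier R" for x
    using that conj_in conj_algebraic_int by simp
  have P_def: "P = Q \<inter> {x \<in> F. algebraic_int x}"
    using over by (simp add: lies_over_def)
  have PQ: "P \<subseteq> Q" and PR: "P \<subseteq> carrier R" and PF: "P \<subseteq> F"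
    using Q_carrier by (auto simp: P_def)
  define E where "E = genideal R P"
  have E_ideal: "ideal E R"
    unfolding E_def using PR by (intro Q.genideal_ideal)
  have PE: "P \<subseteq> E"
    unfolding E_def using PR by (intro Q.genideal_self)
  have EQ: "E \<subseteq> Q"
    unfolding E_def using PQ Q.genideal_minimal[OF Q.is_ideal] by blast
  have E_cases: "\<exists>a b. a \<in> carrier R \<and> b \<in> carrier R \<and> x = p1 * a + p2 * b" if "x \<in> E" for x
  proof -
    have "P \<subseteq> {p1 * a + p2 * b | a b. a \<in> carrier R \<and> b \<in> carrier R}"
    proof
      fix y
      assume "y \<in> P"
      then obtain m n where "y = p1 * of_int m + p2 * of_int n"
        using gens(3) by (metis mult.commute)
      then show "y \<in> {p1 * a + p2 * b | a b. a \<in> carrier R \<and> b \<in> carrier R}"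
        using int_R by blast
    qed
    then have "P \<subseteq> {p1 \<otimes>\<^bsub>R\<^esub> a \<oplus>\<^bsub>R\<^esub> p2 \<otimes>\<^bsub>R\<^esub> b | a b. a \<in> carrier R \<and> b \<in> carrier R}"
      by simp
    then obtain a b where "a \<in> carrier R" "b \<in> carrier R" "x = p1 \<otimes>\<^bsub>R\<^esub> a \<oplus>\<^bsub>R\<^esub> p2 \<otimes>\<^bsub>R\<^esub> b"
      using genideal_two_generators[OF Q.is_cring, of p1 p2 P x] gens(1,2) PR \<open>x \<in> E\<close>
      unfolding E_def by blast
    then show ?thesis
      unfolding R_simps(2,3) by blast
  qed
  have E_add: "x + y \<in> E" if "x \<in> E" "y \<in> E" for x y
    using additive_subgroup.a_closed[OF ideal.axioms(1)[OF E_ideal] that] by simp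
  have E_mult: "x * y \<in> E" if "x \<in> E" "y \<in> carrier R" for x y
    using ideal.I_r_closed[OF E_ideal that] by simp
  have E_combination: "t + x * u + y * v + z * r \<in> E"
    if "t \<in> E" "x \<in> E" "y \<in> E" "z \<in> E" "u \<in> carrier R" "v \<in> carrier R" "r \<in> carrier R"
    for t x y z u v r
    using that by (intro E_add E_mult)
  \<comment> \<open>\<open>Q\<close> may be moved by \<open>conj\<close>, but \<open>E\<close> is
    not: its generators lie in \<open>F\<close>.\<close>
  have E_conj: "conj x \<in> E" if x: "x \<in> E" for x
  proof -
    obtain a b where ab: "a \<in> carrier R" "b \<in> carrier R" "x = p1 * a + p2 * b"
      using E_cases[OF x] by blast
    have p: "p1 \<in> F" "p2 \<in> F" "p1 \<in> M" "p2 \<in> M"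
      using gens(1,2) PF base_subset by auto
    have "conj x = p1 * conj a + p2 * conj b"
      using ab p by (simp add: conj_add conj_mult conj_base MI)
    also have "\<dots> \<in> E"
      using gens(1,2) PE ab(1,2) by (intro E_add E_mult conj_R) auto
    finally show ?thesis .
  qed
  define c d where "c = conj \<beta>" and "d = \<beta> - c"
  have \<beta>_R: "\<beta> \<in> carrier R" and c_R: "c \<in> carrier R" and d_R: "d \<in> carrier R"
    using \<beta> conj_R R_diff by (auto simp: c_def d_def)
  have d_notin: "d \<notin> Q"
    using \<beta>(3) by (simp add: d_def c_def)
  have no_div: "\<not> Q [^]\<^bsub>ideals_set R\<^esub> e divides\<^bsub>ideals_set R\<^esub> E" if e: "e \<ge> 2" for e :: nat
  proof
    assume "Q [^]\<^bsub>ideals_set R\<^esub> e divides\<^bsub>ideals_set R\<^esub> E"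
    then obtain I where I: "ideal I R" "I \<subseteq> Q" "E = Q \<cdot>\<^bsub>R\<^esub> I" "I \<cdot>\<^bsub>R\<^esub> I \<subseteq> E"
      using Q.ideal_power_dvdD[OF Q.is_ideal E_ideal _ e] by metis
    \<comment> \<open>The square of \<open>z\<close> is in \<open>I I\<close>, hence in
      \<open>E\<close>, and so is its conjugate. Thus the square of \<open>conj z\<close> is in
      \<open>Q\<close>, and primality gives \<open>conj z\<close> itself.\<close>
    have trace: "z + conj z \<in> P" if z: "z \<in> I" for z
    proof -
      have "z * z \<in> E"
        using I(4) ideal_prod.prod[OF z z, of R] by auto
      then have "conj z * conj z \<in> E"
        using E_conj[of "z * z"] z I(2) Q_carrier by (auto simp: conj_mult)
      then have "conj z \<in> Q"
        using EQ Q_prime conj_R Q_carrier z I(2) by blast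
      then have "z + conj z \<in> Q"
        using z I(2) Q_add by blast
      moreover have "z + conj z \<in> F"
        using z I(2) Q_carrier trace_in_base by auto
      ultimately show ?thesis
        using Q_carrier by (auto simp: P_def)
    qed
    have dI: "d * d * x \<in> E" if x: "x \<in> I" for x
    proof -
      define s where "s = conj x"
      have I_mult: "x * y \<in> I" if "y \<in> carrier R" for y
        using ideal.I_r_closed[OF I(1) x that] by simp
      have xM: "x \<in> M" and \<beta>M: "\<beta> \<in> M" "c \<in> M" "conj c = \<beta>"
        using x I(2) Q_carrier \<beta>_R c_R conj_conj by (auto simp: c_def)
      have 1: "x * (c * c) + s * (\<beta> * \<beta>) \<in> P"
        using trace[OF I_mult[of "c * c"]] c_R R_mult[OF c_R c_R] xM \<beta>M by (simp add: conj_mult MI s_def)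
      have 2: "x + s \<in> P"
        using trace[OF x] by (simp add: s_def)
      have 3: "x * \<beta> + s * c \<in> P"
        using trace[OF I_mult[OF \<beta>_R]] xM \<beta>M by (simp add: conj_mult MI s_def c_def)
      have 4: "x * c + s * \<beta> \<in> P"
        using trace[OF I_mult[OF c_R]] xM \<beta>M by (simp add: conj_mult MI s_def)
      \<comment> \<open>The brackets are the traces of \<open>x * (c * c)\<close>, \<open>x\<close>,
        \<open>x * \<beta>\<close> and \<open>x * c\<close>. The second and third summands add up to
        \<open>d * \<beta> * x\<close>, the first and fourth to \<open>- d * c * x\<close>.\<close>
      have "d * d * x = (x * (c * c) + s * (\<beta> * \<beta>)) + (x + s) * (0 - \<beta> * c)
          + (x * \<beta> + s * c) * \<beta> + (x * c + s * \<beta>) * (0 - \<beta>)"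
        unfolding d_def by (simp add: algebra_simps)
      also have "\<dots> \<in> E"
      proof (rule E_combination)
        show "0 - \<beta> * c \<in> carrier R" "0 - \<beta> \<in> carrier R"
          using int_R[of 0] by (simp_all only: of_int_0 R_diff R_mult \<beta>_R c_R)
      qed (use 1 2 3 4 PE \<beta>_R in blast)+
      finally show ?thesis .
    qed
    \<comment> \<open>For a product of \<open>i\<close> in \<open>Q\<close> and \<open>j\<close> in
      \<open>I\<close>, \<open>d * d * j\<close> lies in \<open>E\<close> and so is a combination of
      \<open>p1\<close> and \<open>p2\<close>; the factor \<open>i\<close> moves its coefficients
      into \<open>Q\<close>.\<close>
    have dE: "\<exists>s\<in>Q. \<exists>t\<in>Q. d * d * x = p1 * s + p2 * t" if x: "x \<in> E" for x
    proof -
      from x have "x \<in> Q \<cdot>\<^bsub>R\<^esub> I"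
        using I(3) by simp
      then show ?thesis
      proof (induction rule: ideal_prod.induct)
        case (prod i j)
        obtain a b where ab: "a \<in> carrier R" "b \<in> carrier R" "d * d * j = p1 * a + p2 * b"
          using E_cases[OF dI[OF prod(2)]] by blast
        have "d * d * (i * j) = i * (d * d * j)"
          by simp
        also have "\<dots> = p1 * (i * a) + p2 * (i * b)"
          unfolding ab(3) by (simp add: algebra_simps)
        finally show ?case
          using Q_mult(1)[OF prod(1)] ab by (metis R_simps(2))
      next
        case (sum x y)
        then obtain s t s' t' where *: "s \<in> Q" "t \<in> Q" "d * d * x = p1 * s + p2 * t"
          "s' \<in> Q" "t' \<in> Q" "d * d * y = p1 * s' + p2 * t'"
          by blast
        have "d * d * (x + y) = d * d * x + d * d * y"
          by (simp add: algebra_simps)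
        also have "\<dots> = p1 * (s + s') + p2 * (t + t')"
          unfolding *(3,6) by (simp add: algebra_simps)
        finally show ?case
          using Q_add * by (metis R_simps(3))
      qed
    qed
    obtain a b where ab: "a \<in> Q" "b \<in> Q" "d * d * p1 = p1 * a + p2 * b"
      using dE gens(1) PE by blast
    obtain a' b' where ab': "a' \<in> Q" "b' \<in> Q" "d * d * p2 = p1 * a' + p2 * b'"
      using dE gens(2) PE by blast
    \<comment> \<open>\<open>D\<close> is the characteristic polynomial of the 2 by 2 matrix with
      rows \<open>a\<close>, \<open>b\<close> and \<open>a'\<close>, \<open>b'\<close>, evaluated at
      \<open>d * d\<close>. It annihilates both generators, one of which is nonzero, so it vanishes;
      modulo \<open>Q\<close> only the fourth power of \<open>d\<close> survives.\<close>
    define D where "D = d * d * (d * d) - (d * d * (a + b') - (a * b' - a' * b))"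
    have "D * p1 = 0"
    proof -
      have "(d * d - a) * p1 = b * p2" "(d * d - b') * p2 = a' * p1"
        using ab(3) ab'(3) by (simp_all add: algebra_simps)
      then have "(d * d - b') * ((d * d - a) * p1) = b * (a' * p1)"
        by (metis mult.left_commute)
      then show ?thesis
        unfolding D_def by (simp add: algebra_simps)
    qed
    moreover have "D * p2 = 0"
    proof -
      have "(d * d - a) * p1 = b * p2" "(d * d - b') * p2 = a' * p1"
        using ab(3) ab'(3) by (simp_all add: algebra_simps)
      then have "(d * d - a) * ((d * d - b') * p2) = a' * (b * p2)"
        by (metis mult.left_commute)
      then show ?thesis
        unfolding D_def by (simp add: algebra_simps)
    qed
    moreover have "p1 \<noteq> 0 \<or> p2 \<noteq> 0"
    proof (rule ccontr)
      assume "\<not> (p1 \<noteq> 0 \<or> p2 \<noteq> 0)"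
      then have "P \<subseteq> {0}"
        using gens(3) by auto
      with P(2) gens(1) show False
        by blast
    qed
    ultimately have "D = 0"
      by auto
    then have "d * d * (d * d) = d * d * (a + b') - (a * b' - a' * b)"
      by (simp add: D_def)
    also have "\<dots> \<in> Q"
      using ab ab' d_R Q_carrier by (intro Q_diff Q_mult(2) Q_mult(1) Q_add R_mult) auto
    finally have "d \<in> Q"
      using Q_prime d_R R_mult by blast
    with d_notin show False
      by contradiction
  qed
  interpret S: comm_monoid "ideals_set R"
    by (rule Q.ideals_set_is_comm_monoid)
  \<comment> \<open>A greatest exponent exists only once some exponent is admissible and all are
    bounded: 0 is admissible, and \<open>no_div\<close> bounds them by 1.\<close>
  have "Q [^]\<^bsub>ideals_set R\<^esub> (0::nat) divides\<^bsub>ideals_set R\<^esub> E"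
  proof -
    have "E \<in> carrier (ideals_set R)"
      using E_ideal by (simp add: ideals_set_def)
    moreover from this have "E = Q [^]\<^bsub>ideals_set R\<^esub> (0::nat) \<otimes>\<^bsub>ideals_set R\<^esub> E"
      by simp
    ultimately show ?thesis
      unfolding factor_def by blast
  qed
  then have "Q [^]\<^bsub>ideals_set R\<^esub> (GREATEST e::nat. Q [^]\<^bsub>ideals_set R\<^esub> e divides\<^bsub>ideals_set R\<^esub> E)
      divides\<^bsub>ideals_set R\<^esub> E"
  proof (rule GreatestI_nat[where b = 1])
    show "e \<le> 1" if "Q [^]\<^bsub>ideals_set R\<^esub> e divides\<^bsub>ideals_set R\<^esub> E" for e :: nat
      using that no_div[of e] by linarith
  qed
  then have "\<not> (GREATEST e::nat. Q [^]\<^bsub>ideals_set R\<^esub> e divides\<^bsub>ideals_set R\<^esub> E) \<ge> 2"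
    using no_div by blast
  then show ?thesis
    by (simp add: ramification_index_def R_def E_def)
qed

end


section \<open>Two-generated lattices\<close>

text \<open>Division with remainder by a nonzero element of least absolute value; the zero subgroup
  has the generator 0.\<close>

lemma int_subgroup_generator:
  fixes V :: "int set"
  assumes "0 \<in> V" and diff: "\<And>x y. x \<in> V \<Longrightarrow> y \<in> V \<Longrightarrow> x - y \<in> V"
  shows "\<exists>d\<in>V. \<forall>x\<in>V. d dvd x"
proof (cases "V = {0}")
  case False
  then have "\<exists>x. x \<in> V \<and> x \<noteq> 0"
    using assms(1) by blast
  then obtain d where d: "d \<in> V" "d \<noteq> 0" and least: "\<And>y. y \<in> V \<Longrightarrow> y \<noteq> 0 \<Longrightarrow> nat \<bar>d\<bar> \<le> nat \<bar>y\<bar>"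
    using ex_has_least_nat[of "\<lambda>x. x \<in> V \<and> x \<noteq> 0" _ "\<lambda>x. nat \<bar>x\<bar>"] by blast
  have neg: "- x \<in> V" if "x \<in> V" for x
    using diff[OF assms(1) that] by simp
  have add: "x + y \<in> V" if "x \<in> V" "y \<in> V" for x y
    using diff[OF that(1) neg[OF that(2)]] by simp
  have "int n * d \<in> V" for n
    by (induction n) (use assms(1) add d(1) in \<open>auto simp: algebra_simps\<close>)
  then have mult: "k * d \<in> V" for k
    using neg by (cases k rule: int_cases2) auto
  have "d dvd x" if "x \<in> V" for x
  proof (rule ccontr)
    assume "\<not> d dvd x"
    then have "x mod d \<noteq> 0"
      by (simp add: dvd_eq_mod_eq_0)
    moreover have "x mod d \<in> V"
      using diff[OF that mult[of "x div d"]] by (simp add: minus_div_mult_eq_mod)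
    moreover have "\<bar>x mod d\<bar> < \<bar>d\<bar>"
      using abs_mod_less[OF d(2)] by simp
    ultimately show False
      using least by force
  qed
  with d(1) show ?thesis
    by blast
qed auto

text \<open>Triangular form of a basis: \<open>p2\<close> has a second coordinate generating all
  second coordinates that occur, \<open>p1\<close> generates the members of \<open>A\<close> that
  are integer multiples of \<open>e1\<close>. Subtracting a multiple of \<open>p2\<close> reduces
  any element to a multiple of \<open>p1\<close>.\<close>

lemma lattice_subgroup_two_generators:
  fixes A :: "complex set"
  assumes "0 \<in> A" and diff: "\<And>x y. x \<in> A \<Longrightarrow> y \<in> A \<Longrightarrow> x - y \<in> A"
    and lattice: "\<And>x. x \<in> A \<Longrightarrow> \<exists>u v. x = of_int u * e1 + of_int v * e2"
  shows "\<exists>p1\<in>A. \<exists>p2\<in>A. \<forall>x\<in>A. \<exists>m n. x = of_int m * p1 + of_int n * p2"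
proof -
  have neg: "- x \<in> A" if "x \<in> A" for x
    using diff[OF assms(1) that] by simp
  have add: "x + y \<in> A" if "x \<in> A" "y \<in> A" for x y
    using diff[OF that(1) neg[OF that(2)]] by simp
  have "of_nat n * x \<in> A" if "x \<in> A" for n x
    by (induction n) (use assms(1) add that in \<open>auto simp: algebra_simps\<close>)
  then have mult: "of_int k * x \<in> A" if "x \<in> A" for k x
    using neg that by (cases k rule: int_cases2) auto
  define V where "V = {v. \<exists>u. of_int u * e1 + of_int v * e2 \<in> A}"
  have "\<exists>d\<in>V. \<forall>x\<in>V. d dvd x"
  proof (rule int_subgroup_generator)
    show "0 \<in> V"
      using assms(1) by (auto simp: V_def intro!: exI[of _ 0])
    show "v - v' \<in> V" if vv: "v \<in> V" "v' \<in> V" for v v'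
    proof -
      obtain u u' where "of_int u * e1 + of_int v * e2 \<in> A" "of_int u' * e1 + of_int v' * e2 \<in> A"
        using vv unfolding V_def by blast
      from diff[OF this] have "of_int (u - u') * e1 + of_int (v - v') * e2 \<in> A"
        by (simp add: algebra_simps)
      then show ?thesis
        unfolding V_def by blast
    qed
  qed
  then obtain v0 u0 where v0: "\<And>v. v \<in> V \<Longrightarrow> v0 dvd v" and p2: "of_int u0 * e1 + of_int v0 * e2 \<in> A" (is "?p2 \<in> _")
    unfolding V_def by blast
  define U where "U = {u. of_int u * e1 \<in> A}"
  have "\<exists>d\<in>U. \<forall>x\<in>U. d dvd x"
    by (rule int_subgroup_generator) (use assms(1) diff in \<open>auto simp: U_def algebra_simps\<close>)
  then obtain u1 where u1: "\<And>u. u \<in> U \<Longrightarrow> u1 dvd u" and p1: "of_int u1 * e1 \<in> A" (is "?p1 \<in> _")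
    unfolding U_def by blast
  have "\<exists>m n. x = of_int m * ?p1 + of_int n * ?p2" if x: "x \<in> A" for x
  proof -
    obtain u v where uv: "x = of_int u * e1 + of_int v * e2"
      using lattice[OF x] by blast
    then have "v \<in> V"
      using x unfolding V_def by blast
    then obtain n where n: "v = v0 * n"
      using v0 by blast
    have "x - of_int n * ?p2 = of_int (u - n * u0) * e1"
      unfolding uv n by (simp add: algebra_simps)
    moreover have "x - of_int n * ?p2 \<in> A"
      using diff[OF x mult[OF p2]] .
    ultimately have "u - n * u0 \<in> U"
      unfolding U_def by simp
    then obtain m where m: "u - n * u0 = u1 * m"
      using u1 by blast
    have "x = (x - of_int n * ?p2) + of_int n * ?p2"
      by simp
    also have "x - of_int n * ?p2 = of_int m * ?p1"
      unfolding \<open>x - of_int n * ?p2 = of_int (u - n * u0) * e1\<close> m by simp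
    finally show ?thesis
      by blast
  qed
  with p1 p2 show ?thesis
    by blast
qed

text \<open>The traces of \<open>x\<close> and \<open>x w\<close> are integers, so \<open>x\<close> lies in the lattice spanned by \<open>1 / 2\<close> and \<open>w / (2 k)\<close>.\<close>

lemma quadratic_field_ideal_two_generators:
  assumes ext: "quadratic_extension \<rat> w" and w: "w * w = of_int k"
    and R: "cring (integer_ring (quadratic_extension.M \<rat> w))"
    and P: "ideal P (integer_ring (quadratic_extension.M \<rat> w))"
  shows "\<exists>p1\<in>P. \<exists>p2\<in>P. \<forall>x\<in>P. \<exists>m n. x = of_int m * p1 + of_int n * p2"
proof -
  interpret E: quadratic_extension \<rat> w by (rule ext)
  interpret R: cring "integer_ring E.M" by (rule R)
  interpret P: ideal P "integer_ring E.M" by (rule P)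
  have [simp]: "k \<noteq> 0"
    using w E.w_notin by auto
  have w_alg: "algebraic_int w"
    using w by (rule algebraic_int_of_square)
  have trace: "x + E.conj x \<in> \<int>" if "x \<in> E.M" "algebraic_int x" for x
  proof (rule rational_algebraic_int_is_int)
    show "algebraic_int (x + E.conj x)"
      using R.a_closed[of x "E.conj x"] that E.conj_in E.conj_algebraic_int by simp
    show "x + E.conj x \<in> \<rat>"
      using E.trace_in_base that(1) .
  qed
  show ?thesis
  proof (rule lattice_subgroup_two_generators[where ?e1.0 = "1 / 2" and ?e2.0 = "w / (2 * of_int k)"])
    show "0 \<in> P"
      using additive_subgroup.zero_closed[OF P.is_additive_subgroup] by simp
    show "x - y \<in> P" if "x \<in> P" "y \<in> P" for x y
    proof -
      have "- y = - 1 * y" "- 1 \<in> carrier (integer_ring E.M)"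
        using E.MI(2,5) by auto
      then have "- y \<in> P"
        using P.I_l_closed[OF that(2)] by fastforce
      then show ?thesis
        using additive_subgroup.a_closed[OF P.is_additive_subgroup that(1)] by fastforce
    qed
    show "\<exists>u v. x = of_int u * (1 / 2) + of_int v * (w / (2 * of_int k))" if x: "x \<in> P" for x
    proof -
      have xM: "x \<in> E.M" "algebraic_int x"
        using P.Icarr[OF x] by auto
      then have xw: "x * w \<in> E.M" "algebraic_int (x * w)"
        using R.m_closed[of x w] E.w_in w_alg by auto
      obtain a b where ab: "a \<in> \<rat>" "b \<in> \<rat>" "x = a + b * w"
        using xM by (blast elim: E.M_cases)
      have "x + E.conj x = 2 * a"
        unfolding ab(3) E.conj_eq[OF ab(1,2)] by simp
      then obtain u where u: "2 * a = of_int u"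
        using trace[OF xM] by (auto elim: Ints_cases)
      have "x * w = b * of_int k + a * w"
        unfolding ab(3) by (simp add: algebra_simps flip: w)
      moreover have "b * of_int k \<in> \<rat>"
        using ab(2) by simp
      ultimately have "x * w + E.conj (x * w) = 2 * b * of_int k"
        using E.conj_eq[OF _ ab(1)] by simp
      then obtain v where v: "2 * b * of_int k = of_int v"
        using trace[OF xw] by (auto elim: Ints_cases)
      have "x = of_int u * (1 / 2) + of_int v * (w / (2 * of_int k))"
        unfolding ab(3) u[symmetric] v[symmetric] by simp
      then show ?thesis
        by blast
    qed
  qed
qed


section \<open>An unramified quadratic extension\<close>

text \<open>
  At primes not above \<open>r\<close> the different of \<open>K(w) / K\<close> is controlled by \<open>(1 + w) / 2\<close>, at primes above
  \<open>r\<close> by \<open>v / w\<close>, whose square is the integer \<open>m\<close> prime to \<open>r\<close>.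
\<close>

lemma unramified_quadratic:
  fixes v w :: complex and N :: nat and r m :: int
  assumes ext: "quadratic_extension \<rat> v" and v: "v * v = - of_nat N" and "N > 0"
    and K_def: "K = quadratic_extension.M \<rat> v"
    and w: "w * w = of_int r" and w_notin: "w \<notin> K" and r: "[r = 1] (mod 4)"
    and m: "r * m = - int N" and coprime: "Rings.coprime r m"
  shows "abelian_extension K (quadratic_extension.M K w)"
    and "unramified_extension K (quadratic_extension.M K w)"
proof -
  interpret Q: quadratic_extension \<rat> v by (rule ext)
  interpret E: quadratic_extension K w
  proof
    show "number_field K"
      unfolding K_def by (rule Q.number_field_M)
    show "w * w \<in> K"
      unfolding w K_def by (rule subfield_complex_of_int[OF Q.subfield_M])
  qed (rule w_notin)
  show "abelian_extension K E.M"
    by (rule E.abelian_extension)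
  have vK: "v \<in> K"
    unfolding K_def by (rule Q.w_in)
  have "r \<noteq> 0"
    using r by (auto simp: cong_def)
  then have [simp]: "w \<noteq> 0" "r \<noteq> 0"
    using w by auto
  obtain j where j: "1 - r = 4 * j"
    using r by (metis cong_iff_dvd_diff cong_sym dvdE)
  define \<alpha> \<gamma> where "\<alpha> = (1 + w) / 2" and "\<gamma> = v / w"
  \<comment> \<open>Coordinates over \<open>K\<close>; since \<open>w * w = r\<close>,
    \<open>v / w\<close> equals \<open>(v / r) * w\<close> and is negated by
    \<open>E.conj\<close>.\<close>
  have \<alpha>_eq: "\<alpha> = 1 / 2 + 1 / 2 * w" and \<gamma>_eq: "\<gamma> = 0 + v / of_int r * w"
    using w by (simp_all add: \<alpha>_def \<gamma>_def field_simps)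
  have half: "1 / 2 \<in> K" and vr: "v / of_int r \<in> K"
    using E.baseI(8)[OF E.baseI(2) subfield_complex_of_int[OF E.subfield_base, of 2]]
      E.baseI(8)[OF vK subfield_complex_of_int[OF E.subfield_base, of r]] by simp_all
  have \<alpha>: "\<alpha> \<in> E.M" "\<alpha> - E.conj \<alpha> = w"
    unfolding \<alpha>_eq E.conj_eq[OF half half] using E.M_memI[OF half half] by simp_all
  have \<gamma>: "\<gamma> \<in> E.M" "\<gamma> - E.conj \<gamma> = 2 * \<gamma>"
    unfolding \<gamma>_eq E.conj_eq[OF E.baseI(1) vr] using E.M_memI[OF E.baseI(1) vr] by simp_all
  \<comment> \<open>The congruence of \<open>r\<close> modulo 4 enters here: the constant term
    \<open>(1 - r) / 4\<close> is an integer.\<close>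
  have "\<alpha> * \<alpha> - \<alpha> + of_int j = 0"
  proof -
    have "of_int (4 * j) = 1 - w * w"
      using j w by (metis of_int_1 of_int_diff)
    moreover have "4 * (\<alpha> * \<alpha> - \<alpha>) = w * w - 1"
      by (simp add: \<alpha>_def field_simps)
    ultimately have "4 * (\<alpha> * \<alpha> - \<alpha> + of_int j) = 0"
      by (simp add: distrib_left)
    then show ?thesis
      by (simp only: mult_eq_0_iff) simp
  qed
  then have \<alpha>_int: "algebraic_int \<alpha>"
    by (intro algebraic_int.intros[of "[:of_int j, - 1, 1:]"])
      (auto simp: coeff_pCons algebra_simps split: nat.splits)
  have \<gamma>_sq: "\<gamma> * \<gamma> = of_int m"
  proof -
    have "of_int r * (\<gamma> * \<gamma>) = v * v"
      by (simp add: \<gamma>_def field_simps flip: w)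
    also have "\<dots> = of_int (r * m)"
      by (simp add: v m)
    finally show ?thesis
      by simp
  qed
  then have \<gamma>_int: "algebraic_int \<gamma>"
    by (rule algebraic_int_of_square)
  have finite: "\<not> ramifies_finite K E.M P" if P: "primeideal P (integer_ring K)" "P \<noteq> {0}" for P
  proof
    assume "ramifies_finite K E.M P"
    then obtain Q where Q: "primeideal Q (integer_ring E.M)" "lies_over K Q P" "ramification_index E.M P Q > 1"
      unfolding ramifies_finite_def by blast
    interpret P: primeideal P "integer_ring K" by (rule P)
    interpret Q: primeideal Q "integer_ring E.M" by (rule Q)
    \<comment> \<open>That the integers of \<open>K\<close> form a ring is part of \<open>P\<close>
      being a prime ideal there, whence \<open>P.is_cring\<close>.\<close>
    obtain p1 p2 where gens: "p1 \<in> P" "p2 \<in> P" "\<And>x. x \<in> P \<Longrightarrow> \<exists>m n. x = of_int m * p1 + of_int n * p2"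
      using quadratic_field_ideal_two_generators[OF ext, of "- int N" P] v P.is_cring P.is_ideal
      unfolding K_def[symmetric] by auto
    have int: "of_int k \<in> carrier (integer_ring E.M)" for k
      using subfield_complex_of_int[OF E.subfield_M] by auto
    have mult: "x * y \<in> Q" if "x \<in> Q" "y \<in> carrier (integer_ring E.M)" for x y
      using Q.I_r_closed[OF that] by simp
    \<comment> \<open>The candidates \<alpha> and \<gamma> have differences \<open>w\<close> and
      \<open>2 * \<gamma>\<close>, with squares \<open>r\<close> and \<open>4 * m\<close>. As
      \<open>r\<close> is odd and coprime to \<open>m\<close>, both squares in \<open>Q\<close>
      would put 1 into \<open>Q\<close>.\<close>
    have "\<exists>\<beta>. \<beta> \<in> E.M \<and> algebraic_int \<beta> \<and> \<beta> - E.conj \<beta> \<notin> Q"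
    proof (cases "of_int r \<in> Q")
      case False
      have "w \<notin> Q"
        using False mult[of w w] Q.Icarr[of w] by (auto simp: w)
      then show ?thesis
        using \<alpha> \<alpha>_int by metis
    next
      case True
      have "2 * \<gamma> \<notin> Q"
      proof
        assume *: "2 * \<gamma> \<in> Q"
        have "2 * \<gamma> * (2 * \<gamma>) = of_int (4 * m)"
          by (simp flip: \<gamma>_sq)
        with mult[OF * Q.Icarr[OF *]] have "of_int (4 * m) \<in> Q"
          by metis
        moreover have "Rings.coprime r (4 * m)"
        proof -
          have "odd r"
            using j by presburger
          then have "Rings.coprime r (2 * 2)"
            by (intro coprime_mult_right_iff[THEN iffD2] conjI) (simp_all add: coprime_commute)
          then show ?thesis
            using coprime by (simp add: coprime_mult_right_iff)
        qed
        then obtain a b where ab: "a * r + b * (4 * m) = 1"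
          using bezout_int[of r "4 * m"] by auto
        ultimately have "of_int r * of_int a \<in> Q" "of_int (4 * m) * of_int b \<in> Q"
          using mult True int by blast+
        then have "of_int r * of_int a + of_int (4 * m) * of_int b \<in> Q"
          using additive_subgroup.a_closed[OF Q.is_additive_subgroup] by fastforce
        also have "of_int r * of_int a + of_int (4 * m) * of_int b = complex_of_int (a * r + b * (4 * m))"
          by simp
        finally have "\<one>\<^bsub>integer_ring E.M\<^esub> \<in> Q"
          unfolding ab by simp
        then show False
          using Q.one_imp_carrier Q.I_notcarr by blast
      qed
      then show ?thesis
        using \<gamma> \<gamma>_int by metis
    qed
    then have "ramification_index E.M P Q \<le> 1"
      using E.ramification_index_le_1[OF P Q(1,2) _ _ _ gens] by blast
    with Q(3) show False
      by simp
  qed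
  \<comment> \<open>\<open>K\<close> has no real embedding: the image of \<open>v\<close> would be a
    real number with square \<open>- N\<close>.\<close>
  have infinite: "\<not> some_infinite_ramifies K E.M"
  proof
    assume "some_infinite_ramifies K E.M"
    then obtain \<tau> where hom: "\<tau> \<in> ring_hom (field_ring E.M) complex_field" and real: "\<tau> ` K \<subseteq> \<real>"
      unfolding some_infinite_ramifies_def by blast
    have add: "\<tau> (x + y) = \<tau> x + \<tau> y" if "x \<in> E.M" "y \<in> E.M" for x y
      using ring_hom_add[OF hom, of x y] that by simp
    have zero: "\<tau> 0 = 0"
      using add[of 0 0] E.MI(1) by simp
    have nat_in: "of_nat n \<in> E.M" for n
      using subfield_complex_of_int[OF E.subfield_M, of "int n"] by simp
    have nat: "\<tau> (of_nat n) = of_nat n" for n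
    proof (induction n)
      case (Suc n)
      have "\<tau> 1 = 1"
        using ring_hom_one[OF hom] by simp
      with Suc show ?case
        using add[OF E.MI(2) nat_in[of n]] by simp
    qed (simp add: zero)
    have vM: "v \<in> E.M"
      using vK E.base_subset by blast
    obtain t where t: "\<tau> v = of_real t"
      using real vK by (auto elim!: Reals_cases)
    have "\<tau> (v * v) = of_real (t * t)"
      using ring_hom_mult[OF hom, of v v] vM t by simp
    moreover have "\<tau> (v * v) + \<tau> (of_nat N) = 0"
      using add[of "v * v" "of_nat N"] E.MI(4)[OF vM vM] nat_in zero by (simp add: v)
    ultimately have "complex_of_real (t * t + real N) = of_real 0"
      by (simp add: nat)
    then have "t * t + real N = 0"
      unfolding of_real_eq_iff .
    moreover have "t * t \<ge> 0"
      by simp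
    ultimately show False
      using \<open>N > 0\<close> by linarith
  qed
  show "unramified_extension K E.M"
    unfolding unramified_extension_def using finite infinite by blast
qed


section \<open>Primes of residue degree one\<close>

lemma cring_integer_ring_Rats: "cring (integer_ring \<rat>)"
proof -
  have eq: "{x \<in> \<rat>. algebraic_int x} = (\<int> :: complex set)"
    by (auto intro: rational_algebraic_int_is_int int_imp_algebraic_int Ints_subset_Rats[THEN subsetD])
  have "subring (\<int> :: complex set) complex_field"
    by (rule CF.subringI) auto
  then have "subcring (\<int> :: complex set) complex_field"
    by (rule CF.subcringI')
  then show ?thesis
    using CF.subcring_iff[of "\<int>"] by (simp add: integer_ring_def eq)
qed

text \<open>Rational algebraic integers are integers, so the prime below \<open>Q\<close> consists
  of the multiples of \<open>p\<close>.\<close>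

lemma lies_over_prime_number:
  assumes "lies_over \<rat> Q (genideal (integer_ring \<rat>) {of_nat p})"
  shows "of_int n \<in> Q \<longleftrightarrow> int p dvd n"
proof -
  interpret Z: cring "integer_ring \<rat>" by (rule cring_integer_ring_Rats)
  have p: "of_nat p \<in> carrier (integer_ring \<rat>)"
    by simp
  have int: "of_int k \<in> carrier (integer_ring \<rat>)" for k
    by simp
  have "of_int n \<in> Q \<longleftrightarrow> of_int n \<in> genideal (integer_ring \<rat>) {of_nat p}"
    using assms int[of n] unfolding lies_over_def by blast
  also have "\<dots> \<longleftrightarrow> (\<exists>x\<in>carrier (integer_ring \<rat>). complex_of_int n = x * of_nat p)"
    using Z.cgenideal_eq_genideal[OF p] by (auto simp: cgenideal_def)
  also have "\<dots> \<longleftrightarrow> int p dvd n"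
  proof
    assume "\<exists>x\<in>carrier (integer_ring \<rat>). complex_of_int n = x * of_nat p"
    then obtain x where x: "x \<in> \<rat>" "algebraic_int x" "complex_of_int n = x * of_nat p"
      by auto
    then obtain k where "x = of_int k"
      using rational_algebraic_int_is_int by (auto elim: Ints_cases)
    with x(3) have "complex_of_int n = of_int (k * int p)"
      by simp
    then show "int p dvd n"
      unfolding of_int_eq_iff by simp
  next
    assume "int p dvd n"
    then obtain k where k: "n = int p * k" ..
    show "\<exists>x\<in>carrier (integer_ring \<rat>). complex_of_int n = x * of_nat p"
      by (rule bexI[OF _ int[of k]]) (simp add: k)
  qed
  finally show ?thesis .
qed

text \<open>A residue field of degree 1 consists of integer multiples of one class \<open>b\<close>.
  Comparing \<open>1\<close> with \<open>n0 * b\<close> and \<open>y\<close> with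
  \<open>n * b\<close> shows that \<open>y * n0\<close> is congruent to \<open>n\<close> modulo
  \<open>Q\<close>; squaring gives a congruence of integers modulo \<open>p\<close>, in which
  \<open>n0\<close> is invertible.\<close>

lemma QuadRes_if_residue_degree_1:
  fixes p :: nat
  assumes S: "subfield S complex_field" and "prime p"
    and Q: "primeideal Q (integer_ring S)"
    and over: "lies_over \<rat> Q (genideal (integer_ring \<rat>) {of_nat p})"
    and deg: "has_residue_degree \<rat> S Q 1"
    and y: "y \<in> S" "y * y = of_int k"
  shows "QuadRes (int p) k"
proof -
  define R where "R = integer_ring S"
  interpret Q: primeideal Q R unfolding R_def by (rule Q)
  interpret A: ring "R Quot Q"
    by (rule Q.quotient_is_ring)
  have R_simps [simp]: "carrier R = {x \<in> S. algebraic_int x}" "x \<otimes>\<^bsub>R\<^esub> y = x * y" "x \<oplus>\<^bsub>R\<^esub> y = x + y"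
    "\<zero>\<^bsub>R\<^esub> = 0" "\<one>\<^bsub>R\<^esub> = 1" for x y
    by (simp_all add: R_def)
  note SI = subfield_complexD[OF S]
  note Q_int = lies_over_prime_number[OF over]
  have int: "of_int n \<in> carrier R" for n
    using subfield_complex_of_int[OF S] by auto
  have yR: "y \<in> carrier R"
    using y algebraic_int_of_square by auto
  have R_mult: "a * b \<in> carrier R" if "a \<in> carrier R" "b \<in> carrier R" for a b
    using Q.m_closed[OF that] by (simp only: R_simps(2))
  have Q_mult: "x * y \<in> Q" if "x \<in> Q" "y \<in> carrier R" for x y
    using Q.I_r_closed[OF that] by simp
  have Q_diff: "x - y \<in> Q" if "x \<in> Q" "y \<in> Q" for x y
    using additive_subgroup.a_closed[OF Q.is_additive_subgroup that(1) Q_mult[OF that(2) int[of "- 1"]]]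
    by simp
  let ?Z = "(+>\<^bsub>R\<^esub>) Q ` carrier (integer_ring \<rat>)"
  have "A.dimension (Suc 0) ?Z (carrier (R Quot Q))"
    using deg by (simp add: has_residue_degree_def R_def)
  \<comment> \<open>The basis vector \<open>u\<close> need not be the class of 1, hence the later
    detour through \<open>n0\<close>.\<close>
  then obtain u E where u: "u \<in> carrier (R Quot Q)" "A.dimension 0 ?Z E"
    "carrier (R Quot Q) = A.line_extension ?Z u E"
    by (rule A.dimension.cases) (auto intro: that)
  have E: "E = {\<zero>\<^bsub>R Quot Q\<^esub>}"
    using u(2) by (cases rule: A.dimension.cases) auto
  obtain b where b: "b \<in> carrier R" "u = Q +>\<^bsub>R\<^esub> b"
    using u(1) by (auto simp: FactRing_def A_RCOSETS_def')
  have residue: "\<exists>n. a - of_int n * b \<in> Q" if a: "a \<in> carrier R" for a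
  proof -
    have "Q +>\<^bsub>R\<^esub> a \<in> carrier (R Quot Q)"
      using a by (auto simp: FactRing_def A_RCOSETS_def')
    then obtain z where z: "z \<in> carrier (integer_ring \<rat>)"
      "Q +>\<^bsub>R\<^esub> a = (Q +>\<^bsub>R\<^esub> z) \<otimes>\<^bsub>R Quot Q\<^esub> u \<oplus>\<^bsub>R Quot Q\<^esub> \<zero>\<^bsub>R Quot Q\<^esub>"
      unfolding u(3) A.line_extension_mem_iff E by blast
    from z(1) obtain n where n: "z = of_int n"
      using rational_algebraic_int_is_int by (auto elim: Ints_cases)
    have "Q +>\<^bsub>R\<^esub> z \<in> carrier (R Quot Q)"
      using int[of n] unfolding n by (auto simp: FactRing_def A_RCOSETS_def')
    then have "Q +>\<^bsub>R\<^esub> a = (Q +>\<^bsub>R\<^esub> z) \<otimes>\<^bsub>R Quot Q\<^esub> (Q +>\<^bsub>R\<^esub> b)"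
      using z(2) u(1) b(2) by simp
    also have "\<dots> = Q +>\<^bsub>R\<^esub> (z \<otimes>\<^bsub>R\<^esub> b)"
      using Q.rcoset_mult_add[of z b] int[of n] b(1) by (simp add: FactRing_def n)
    finally have "a \<ominus>\<^bsub>R\<^esub> of_int n * b \<in> Q"
      using Q.quotient_eq_iff_same_a_r_cos[OF Q.is_ideal a R_mult[OF int[of n] b(1)]] by (simp add: n)
    moreover have "a \<ominus>\<^bsub>R\<^esub> of_int n * b = a - of_int n * b"
    proof -
      have "\<ominus>\<^bsub>R\<^esub> x = - x" if "x \<in> carrier R" for x
        using that Q.minus_equality[of "- x" x] SI(5)[of x] by simp
      then show ?thesis
        using R_mult[OF int[of n] b(1)] by (simp add: a_minus_def)
    qed
    ultimately show ?thesis
      by auto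
  qed
  obtain n0 where n0: "1 - of_int n0 * b \<in> Q"
    using residue[of 1] int[of 1] by auto
  obtain n where n: "y - of_int n * b \<in> Q"
    using residue[OF yR] by blast
  have one: "1 \<notin> Q"
    using Q.one_imp_carrier Q.I_notcarr by auto
  have p_n0: "\<not> int p dvd n0"
  proof
    assume "int p dvd n0"
    then have "of_int n0 * b \<in> Q"
      using Q_int Q_mult b(1) by blast
    then have "1 - of_int n0 * b + of_int n0 * b \<in> Q"
      using n0 additive_subgroup.a_closed[OF Q.is_additive_subgroup] by fastforce
    with one show False
      by simp
  qed
  have "(y - of_int n * b) * of_int n0 - (1 - of_int n0 * b) * of_int n \<in> Q"
    by (intro Q_diff Q_mult n n0 int)
  also have "(y - of_int n * b) * of_int n0 - (1 - of_int n0 * b) * of_int n = y * of_int n0 - of_int n"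
    by (simp add: algebra_simps)
  finally have *: "y * of_int n0 - of_int n \<in> Q" .
  \<comment> \<open>Multiplying by this sum replaces \<open>y\<close> by its square \<open>k\<close>
    and leaves an integer in \<open>Q\<close>, that is, a multiple of \<open>p\<close>.\<close>
  have "y * of_int n0 + of_int n \<in> carrier R"
    using Q.a_closed[OF R_mult[OF yR int[of n0]] int[of n]] by (simp only: R_simps(3))
  from Q_mult[OF * this] have "(y * y) * of_int (n0 * n0) - of_int (n * n) \<in> Q"
    by (simp add: algebra_simps)
  then have "of_int (k * (n0 * n0) - n * n) \<in> Q"
    by (simp add: y)
  then have p: "int p dvd k * (n0 * n0) - n * n"
    using Q_int by blast
  have "Rings.coprime n0 (int p)"
    using p_n0 \<open>prime p\<close> prime_imp_coprime[of "int p" n0] by (simp add: coprime_commute)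
  then obtain z where z: "[n0 * z = 1] (mod int p)"
    using cong_solve_coprime_int by blast
  have "[(n * z)\<^sup>2 = (n * n) * (z * z)] (mod int p)"
    by (simp add: power2_eq_square mult_ac)
  also have "[(n * n) * (z * z) = (k * (n0 * n0)) * (z * z)] (mod int p)"
    by (rule cong_mult[OF _ cong_refl]) (use p in \<open>simp add: cong_iff_dvd_diff dvd_diff_commute\<close>)
  also have "[(k * (n0 * n0)) * (z * z) = k * ((n0 * z) * (n0 * z))] (mod int p)"
    by (simp add: mult_ac)
  also have "[k * ((n0 * z) * (n0 * z)) = k * (1 * 1)] (mod int p)"
    by (intro cong_mult cong_refl z)
  finally show ?thesis
    unfolding QuadRes_def by auto
qed


section \<open>Legendre symbols\<close>

text \<open>Euler's criterion fixes the symbol modulo \<open>p\<close>, and two values among -1, 0,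
  1 differ by at most 2, which is less than \<open>p\<close>.\<close>

lemma Legendre_unique:
  assumes "prime p" "2 < p" and "[x = a ^ ((p - 1) div 2)] (mod int p)" and x: "x = 0 \<or> x = 1 \<or> x = -1"
  shows "Legendre a (int p) = x"
proof -
  have "[Legendre a (int p) = x] (mod int p)"
    using euler_criterion[OF assms(1,2), of a] assms(3) cong_sym cong_trans by blast
  then have "int p dvd Legendre a (int p) - x"
    by (simp add: cong_iff_dvd_diff)
  moreover have "\<bar>Legendre a (int p) - x\<bar> < int p"
    using assms(2) x by (auto simp: Legendre_def)
  ultimately show ?thesis
    using dvd_imp_le_int[of "Legendre a (int p) - x" "int p"] by fastforce
qed

lemma Legendre_mult:
  assumes "prime p" "2 < p"
  shows "Legendre (a * b) (int p) = Legendre a (int p) * Legendre b (int p)"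
proof (rule Legendre_unique[OF assms])
  show "[Legendre a (int p) * Legendre b (int p) = (a * b) ^ ((p - 1) div 2)] (mod int p)"
    unfolding power_mult_distrib by (intro cong_mult euler_criterion assms)
qed (auto simp: Legendre_def)

lemma Legendre_minus_1:
  assumes "prime p" "2 < p"
  shows "Legendre (- 1) (int p) = (- 1) ^ ((p - 1) div 2)"
  by (rule Legendre_unique[OF assms]) (auto simp: minus_one_power_iff)

lemma Legendre_eq_1_if_QuadRes:
  assumes "QuadRes p a" "\<not> p dvd a"
  shows "Legendre a p = 1"
  using assms by (simp add: Legendre_def cong_0_iff)

text \<open>If \<open>q\<close> is 1 mod 4, then -1 is a residue mod \<open>q\<close> and the
  reciprocity sign is 1. Otherwise -1 is a nonresidue mod \<open>q\<close>, and
  \<open>(q/p) = (N/p) = -(-1/p)\<close>; the reciprocity sign is \<open>(-1/p)\<close>, so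
  \<open>(p/q) = -1\<close> and the two signs cancel.\<close>

lemma Legendre_minus_prime:
  fixes p q :: nat
  assumes p: "prime p" "2 < p" and q: "prime q" "2 < q" and "p \<noteq> q"
    and N: "Legendre (- N) (int p) = - 1"
    and res: "if q mod 4 = 1 then Legendre (int q) (int p) = 1 else Legendre (int q * N) (int p) = 1"
  shows "Legendre (- int p) (int q) = 1"
proof -
  have rec: "Legendre (int p) (int q) * Legendre (int q) (int p) = (- 1) ^ ((p - 1) div 2 * ((q - 1) div 2))"
    using Quadratic_Reciprocity[OF p q \<open>p \<noteq> q\<close>] .
  have split: "Legendre (- int p) (int q) = (- 1) ^ ((q - 1) div 2) * Legendre (int p) (int q)"
    using Legendre_mult[OF q, of "- 1" "int p"] Legendre_minus_1[OF q] by simp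
  have "odd q"
    using q prime_odd_nat by auto
  show ?thesis
  proof (cases "q mod 4 = 1")
    case True
    then have "even ((q - 1) div 2)"
      by presburger
    with True rec split res show ?thesis
      by simp
  next
    case False
    with \<open>odd q\<close> have odd: "odd ((q - 1) div 2)"
      by presburger
    have "Legendre (int q) (int p) * Legendre N (int p) = 1"
      using False res Legendre_mult[OF p] by simp
    moreover have "(- 1) ^ ((p - 1) div 2) * Legendre N (int p) = - 1"
      using N Legendre_mult[OF p, of "- 1" N] Legendre_minus_1[OF p] by simp
    ultimately have "Legendre (int q) (int p) = - ((- 1) ^ ((p - 1) div 2))"
      by (cases "even ((p - 1) div 2)") (auto simp: zmult_eq_1_iff)
    moreover have "Legendre (int p) (int q) * Legendre (int q) (int p) = (- 1) ^ ((p - 1) div 2)"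
      using rec odd by (simp add: minus_one_power_iff)
    ultimately have "Legendre (int p) (int q) = - 1"
      by (cases "even ((p - 1) div 2)") auto
    with odd split show ?thesis
      by simp
  qed
qed


section \<open>Genus theory of imaginary quadratic fields\<close>

theorem theorem1:
  fixes N p :: nat and K \<Sigma> \<Sigma>\<^sub>0 \<pp> :: "complex set"
  assumes "N > 0" and "squarefree N"
    and "K = imaginary_quadratic_field N"
    and "hilbert_class_field K \<Sigma>"
    and "\<Sigma>\<^sub>0 = \<Sigma> \<inter> \<real>"
    and "prime p" and "odd p"
    and "Legendre (- int N) (int p) = -1"
    and "primeideal \<pp> (integer_ring \<Sigma>\<^sub>0)"
    and "lies_over \<rat> \<pp> (genideal (integer_ring \<rat>) {of_nat p})"
    and "has_residue_degree \<rat> \<Sigma>\<^sub>0 \<pp> 1"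
  shows "\<forall>q::nat. prime q \<and> odd q \<and> q dvd N \<longrightarrow> Legendre (- int p) (int q) = 1"
proof (intro allI impI, elim conjE)
  fix q :: nat
  assume q: "prime q" "odd q" "q dvd N"
  define v where "v = csqrt (- of_nat N)"
  have v_eq: "v = \<i> * of_real (sqrt (real N))"
    by (simp add: v_def)
  have sqrt: "complex_of_real (sqrt (real n)) * of_real (sqrt (real n)) = of_nat n" for n
    by (simp flip: of_real_mult)
  have "\<i> * a * (\<i> * a) = - (a * a)" for a
    by (simp add: complex_eq_iff algebra_simps)
  then have i_sqrt: "\<i> * complex_of_real (sqrt (real n)) * (\<i> * of_real (sqrt (real n))) = - of_nat n" for n
    by (simp only: sqrt)
  have v: "v * v = - of_nat N"
    by (simp only: v_eq i_sqrt)
  have ext: "quadratic_extension \<rat> v"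
  proof
    show "v \<notin> \<rat>"
    proof
      assume "v \<in> \<rat>"
      then have "v \<in> \<real>"
        by (elim Rats_cases') simp
      then show False
        using \<open>N > 0\<close> by (simp add: v_eq complex_is_Real_iff)
    qed
  qed (simp_all add: v number_field_Rats)
  then have K: "K = quadratic_extension.M \<rat> v"
    using quadratic_extension.M_eq_generate_field assms(3)
    by (simp add: imaginary_quadratic_field_def v_def)
  have abelian: "abelian_extension K \<Sigma>"
    and largest: "\<And>M. abelian_extension K M \<Longrightarrow> unramified_extension K M \<Longrightarrow> M \<subseteq> \<Sigma>"
    using assms(4) by (auto simp: hilbert_class_field_def)
  have K\<Sigma>: "K \<subseteq> \<Sigma>" and sub\<Sigma>: "subfield \<Sigma> complex_field"
    using abelian by (auto simp: abelian_extension_def galois_extension_def number_field_def)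
  have v\<Sigma>: "v \<in> \<Sigma>"
    using K\<Sigma> quadratic_extension.w_in[OF ext] by (auto simp: K)
  obtain t where t: "N = q * t"
    using q(3) ..
  \<comment> \<open>Squarefreeness of \<open>N\<close> makes \<open>r\<close> and its cofactor
    \<open>m\<close> coprime.\<close>
  have "\<not> q dvd t"
  proof
    assume "q dvd t"
    then have "q\<^sup>2 dvd N"
      by (simp add: t power2_eq_square)
    then show False
      using assms(2) q(1) by (auto simp: squarefree_def)
  qed
  then have coprime: "Rings.coprime (int q) (int t)"
    using prime_imp_coprime[OF q(1)] by simp
  define r where "r = (if q mod 4 = 1 then int q else - int q)"
  define m where "m = (if q mod 4 = 1 then - int t else int t)"
  define w where "w = (if q mod 4 = 1 then 1 else \<i>) * of_real (sqrt (real q))"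
  have w: "w * w = of_int r"
    using sqrt[of q] i_sqrt[of q] by (simp add: w_def r_def)
  have "[r = 1] (mod 4)"
  proof (cases "q mod 4 = 1")
    case True
    then have "int q mod 4 = 1"
      using zmod_int[of q 4] by simp
    with True show ?thesis
      by (simp add: r_def cong_def)
  next
    case False
    with q(2) have "q mod 4 = 3"
      by presburger
    then have "int q mod 4 = 3"
      using zmod_int[of q 4] by simp
    then have "- int q mod 4 = 1"
      by presburger
    with False show ?thesis
      by (simp add: r_def cong_def)
  qed
  moreover have "r * m = - int N" "Rings.coprime r m"
    using coprime by (simp_all add: r_def m_def t)
  \<comment> \<open>\<open>w\<close> may already lie in \<open>K\<close>: if \<open>N = q\<close> is
    3 mod 4, then \<open>w = v\<close>. There is then no quadratic extension to consider, and the
    inclusion of \<open>K\<close> in \<open>\<Sigma>\<close> suffices.\<close>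
  ultimately have "w \<in> \<Sigma>"
  proof (cases "w \<in> K")
    case False
    assume "[r = 1] (mod 4)" "r * m = - int N" "Rings.coprime r m"
    note unramified_quadratic[OF ext v \<open>N > 0\<close> K w False this]
    from largest[OF this]
    have "quadratic_extension.M K w \<subseteq> \<Sigma>" .
    moreover have "quadratic_extension K w"
      using quadratic_extension.number_field_M[OF ext] subfield_complex_of_int
        quadratic_extension.subfield_M[OF ext] False
      by (simp add: quadratic_extension_def w K)
    ultimately show ?thesis
      using quadratic_extension.w_in by blast
  qed (use K\<Sigma> in blast)
  \<comment> \<open>In the second case \<open>v\<close> and \<open>w\<close> are both purely
    imaginary, so their product is real, with square \<open>(- N) * (- q)\<close>.\<close>
  define y where "y = (if q mod 4 = 1 then w else v * w)"
  define k where "k = (if q mod 4 = 1 then int q else int q * int N)"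
  have sub\<Sigma>0: "subfield \<Sigma>\<^sub>0 complex_field"
    unfolding assms(5) by (rule subfield_complexI) (use subfield_complexD[OF sub\<Sigma>] in auto)
  have "y \<in> \<Sigma>"
    using \<open>w \<in> \<Sigma>\<close> v\<Sigma> subfield_complexD(4)[OF sub\<Sigma>] by (simp add: y_def)
  moreover have "y \<in> \<real>"
    by (simp add: y_def v_eq w_def complex_is_Real_iff)
  moreover have "y * y = of_int k"
  proof (cases "q mod 4 = 1")
    case True
    then show ?thesis
      using w by (simp add: y_def k_def r_def)
  next
    case False
    have "v * w * (v * w) = (v * v) * (w * w)"
      by (simp add: mult_ac)
    also have "\<dots> = of_int k"
      unfolding v w using False by (simp add: r_def k_def)
    finally show ?thesis
      using False by (simp add: y_def)
  qed
  ultimately have QR: "QuadRes (int p) k"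
    using QuadRes_if_residue_degree_1[OF sub\<Sigma>0 assms(6,9,10,11)] by (simp add: assms(5))
  have p_N: "\<not> p dvd N"
    using assms(8) by (auto simp: Legendre_def cong_0_iff split: if_splits)
  then have "p \<noteq> q"
    using q(3) by auto
  have p_q: "\<not> p dvd q"
    using primes_dvd_imp_eq[OF assms(6) q(1)] \<open>p \<noteq> q\<close> by blast
  have "\<not> int p dvd k"
    using p_N p_q assms(6) by (simp add: k_def prime_dvd_mult_iff flip: of_nat_mult)
  then have Leg: "Legendre k (int p) = 1"
    using QR by (intro Legendre_eq_1_if_QuadRes)
  have "2 < p"
    using prime_ge_2_nat[OF assms(6)] assms(7) by (cases "p = 2") auto
  moreover have "2 < q"
    using prime_ge_2_nat[OF q(1)] q(2) by (cases "q = 2") auto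
  ultimately show "Legendre (- int p) (int q) = 1"
    using Legendre_minus_prime[OF assms(6) _ q(1) _ \<open>p \<noteq> q\<close> assms(8)] Leg
    by (simp add: k_def split: if_splits)
qed

end
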